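(* Let $w$ be a reduced word. Then $Q(w) = \mathrm{LS}(w)$, where $Q(w)$ is the Edelman–Greene recording tableau of $w$ and $\mathrm{LS}(w)$ is the standard Young tableau produced by the Little map.
   Context: Words. A word is a finite sequence $w=w_1w_2\cdots w_m$ of positive integers. For $N>\max_i w_i$ let $s_k\in S_N$ denote the adjacent transposition $(k\ k{+}1)$. The word $w$ is a reduced word (of $\sigma=s_{w_1}s_{w_2}\cdots s_{w_m}$) if $m$ equals the number of inversions of $\sigma$; this does not depend on $N$. Put $\sigma^0=\mathrm{id}$ and $\sigma^l=s_{w_1}\cdots s_{w_l}$; in one-line notation $\sigma^l$ is obtained from $\sigma^{l-1}$ by exchanging the entries in positions $w_l$ and $w_l+1$, and we say the letter $w_l$ swaps these two values. In a reduced word, each pair of values is swapped by at most one letter. Edelman–Greene insertion. To insert a number $x$ into a tableau $T$ with rows $R_1,\dots,R_k$, where $R_1=r_1\le r_2\le\cdots\le r_l$: (1) if $R_1$ is empty or $x\ge r_l$, append $x$ to the end of $R_1$; (2) otherwise let $j$ be smallest with $x<r_j$; (a) if $r_j=x+1$ and $r_{j-1}=x$, leave $R_1$ unchanged and insert $x+1$ into the tableau formed by $R_2,\dots,R_k$; (b) otherwise replace $r_j$ by $x$ in $R_1$ and insert $r_j$ into the tableau formed by $R_2,\dots,R_k$. For $w=w_1\cdots w_m$, let $P_1$ be the result of inserting $w_m$ into the empty tableau and $P_j$ the result of inserting $w_{m-j+1}$ into $P_{j-1}$ (letters are inserted from right to left). Then $P(w)=P_m$, and $Q(w)$ is the standard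 Young tableau of the same shape whose box created at step $j$ contains $j$. Grassmannian words and $\mathrm{Tab}$. A permutation is Grassmannian if it has exactly one descent; write it in one-line notation as $\sigma=a_1\cdots a_k b_1\cdots b_{n-k}$ with $a_1<\cdots<a_k$, $b_1<\cdots<b_{n-k}$, $a_k>b_1$. A reduced word of a Grassmannian permutation is a Grassmannian word. For such a word $w=w_1\cdots w_m$, each letter $w_l$ swaps some value $a_i$ with some value $b_j$; place the entry $m+1-l$ in the cell in the row indexed by $a_i$ and the column indexed by $b_j$, where rows are indexed top to bottom by $a_k,a_{k-1},\dots,a_1$ and columns left to right by $b_1,\dots,b_{n-k}$. Discarding empty rows and columns, the filled cells form a Young diagram and the filling is a standard Young tableau, denoted $\mathrm{Tab}(w)$. Little bumps. For a reduced word $w$ and index $p$, let $w^{(p)}$ be $w$ with its $p$-th letter deleted, and let $w^{(p-)}$ be the word obtained by replacing $w_p$ with $w_p-1$ if $w_p>1$, and, if $w_p=1$, by adding $1$ to every letter other than the $p$-th. Suppose $w$ and $w^{(i)}$ are reduced. The Little bump $w{\uparrow_i}$ is computed thus: set $u=w$, $p=i$; replace $u$ by $u^{(p-)}$; if $u$ is reduced, stop and output $u$; otherwise there is exactly one index $q\ne p$ such that the letters of $u$ in positions $p$ and $q$ swap the same pair of values; set $p=q$ and repeat. (This terminates; each position is modified at most once.) Little map. If $w$ is a Grassmannian word, $\mathrm{LS}(w)=\mathrm{Tab}(w)$. Otherwise, with $\sigma$ the permutation of $w$, let $(r,s)$ be the lexicographically largest inversion of $\sigma$ (pair of positions $r<s$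 with $\sigma_r>\sigma_s$), let $i$ be the position of the letter of $w$ that swaps the values $\sigma_r$ and $\sigma_s$, and set $\mathrm{LS}(w)=\mathrm{LS}(w{\uparrow_i})$. (This recursion terminates.) *)

theory Defs
  imports Main "HOL-Combinatorics.Transposition"
begin

text \<open>
  Words are lists of positive naturals and letters are addressed by their list index, starting
  at 0. The elements of all the symmetric groups \<open>S_N\<close> are represented at once, as functions on
  \<^typ>\<open>nat\<close> that fix 0 and everything above \<open>N\<close>; \<open>f i\<close> is the entry at position \<open>i\<close> of the
  one-line notation.
\<close>

fun word_perm :: "nat list \<Rightarrow> nat \<Rightarrow> nat" where
  "word_perm [] = id"
| "word_perm (k # w) = transpose k (Suc k) \<circ> word_perm w"

definition inversions :: "(nat \<Rightarrow> nat) \<Rightarrow> (nat \<times> nat) set" where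
  "inversions f = {(r, s). 1 \<le> r \<and> r < s \<and> f r > f s}"

definition reduced :: "nat list \<Rightarrow> bool" where
  "reduced w \<longleftrightarrow> (\<forall>k \<in> set w. 1 \<le> k) \<and> length w = card (inversions (word_perm w))"

text \<open>The unordered pair of values swapped by the letter with index \<open>p\<close>.\<close>

definition swapped :: "nat list \<Rightarrow> nat \<Rightarrow> nat set" where
  "swapped w p = {word_perm (take p w) (w ! p), word_perm (take p w) (Suc (w ! p))}"


section \<open>Edelman--Greene insertion\<close>

fun eg_insert :: "nat \<Rightarrow> nat list list \<Rightarrow> nat list list" where
  "eg_insert x [] = [[x]]"
| "eg_insert x (R # T) =
    (if R = [] \<or> last R \<le> x then (R @ [x]) # T
     else let j = (LEAST j. j < length R \<and> x < R ! j) in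
       if R ! j = x + 1 \<and> 0 < j \<and> R ! (j - 1) = x
       then R # eg_insert (x + 1) T
       else R[j := x] # eg_insert (R ! j) T)"

text \<open>\<^const>\<open>foldr\<close> inserts the last letter of the word first.\<close>

definition EG_P :: "nat list \<Rightarrow> nat list list" where
  "EG_P w = foldr eg_insert w []"

definition cells :: "nat list list \<Rightarrow> (nat \<times> nat) set" where
  "cells T = {(i, j). i < length T \<and> j < length (T ! i)}"

text \<open>
  Standard Young tableaux are represented by their fillings: partial maps from cells
  (row, column), both counted from 0, to entries. The domain of the map is the shape.
\<close>

type_synonym filling = "nat \<times> nat \<rightharpoonup> nat"

fun EG_Q :: "nat list \<Rightarrow> filling" where
  "EG_Q [] = Map.empty"
| "EG_Q (x # w) =
    (\<lambda>c. if c \<in> cells (EG_P (x # w)) - cells (EG_P w) then Some (Suc (length w)) else EG_Q w c)"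


section \<open>Grassmannian words\<close>

definition descents :: "(nat \<Rightarrow> nat) \<Rightarrow> nat set" where
  "descents f = {k. 1 \<le> k \<and> f k > f (Suc k)}"

definition grassmannian :: "(nat \<Rightarrow> nat) \<Rightarrow> bool" where
  "grassmannian f \<longleftrightarrow> (\<exists>!k. k \<in> descents f)"

text \<open>
  If \<open>k\<close> is the descent of \<open>\<sigma>\<close>, then \<open>a\<^sub>i = \<sigma> i\<close> for \<open>1 \<le> i \<le> k\<close> and \<open>b\<^sub>j = \<sigma> (k + j)\<close> for \<open>j \<ge> 1\<close>.
  So row \<open>i\<close> of the grid below, counted from 0, belongs to \<open>\<sigma> (k - i)\<close>, and column \<open>j\<close> to
  \<open>\<sigma> (k + 1 + j)\<close>. There is no last column, but only finitely many are nonempty. The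
  letter with index \<open>p\<close> is the \<open>(p + 1)\<close>-st one, so its entry is \<open>m + 1 - (p + 1) = m - p\<close>.
\<close>

definition tab_grid :: "nat list \<Rightarrow> filling" where
  "tab_grid w = (\<lambda>(i, j).
     let \<sigma> = word_perm w; k = (THE k. k \<in> descents \<sigma>);
         here = (\<lambda>p. p < length w \<and> swapped w p = {\<sigma> (k - i), \<sigma> (k + 1 + j)})
     in if i < k \<and> (\<exists>p. here p) then Some (length w - (THE p. here p)) else None)"

definition discard_empty :: "filling \<Rightarrow> filling" where
  "discard_empty F = (\<lambda>(i, j).
     let R = fst ` dom F; C = snd ` dom F
     in if i < card R \<and> j < card C
        then F (sorted_list_of_set R ! i, sorted_list_of_set C ! j) else None)"

definition Tab :: "nat list \<Rightarrow> filling" where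
  "Tab w = discard_empty (tab_grid w)"


section \<open>Little bumps and the Little map\<close>

definition decr :: "nat list \<Rightarrow> nat \<Rightarrow> nat list" where
  "decr w p = (if w ! p > 1 then w[p := w ! p - 1] else (map Suc w)[p := w ! p])"

text \<open>The value \<^const>\<open>None\<close> of the following two functions means that the recursion does not terminate.\<close>

partial_function (option) little_bump :: "nat list \<Rightarrow> nat \<Rightarrow> nat list option" where
  "little_bump u p =
    (let u' = decr u p in
       if reduced u' then Some u'
       else little_bump u' (THE q. q < length u' \<and> q \<noteq> p \<and> swapped u' q = swapped u' p))"

definition last_inversion :: "(nat \<Rightarrow> nat) \<Rightarrow> nat \<times> nat" where
  "last_inversion f = (THE (r, s). (r, s) \<in> inversions f \<and>
     (\<forall>(r', s') \<in> inversions f. r' < r \<or> r' = r \<and> s' \<le> s))"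

text \<open>
  The empty word is the only reduced word whose permutation has no inversions. It is not
  Grassmannian, as the identity has no descent; its image is the empty tableau by convention.
\<close>

partial_function (option) LS :: "nat list \<Rightarrow> filling option" where
  "LS w =
    (if w = [] then Some Map.empty
     else if grassmannian (word_perm w) then Some (Tab w)
     else let \<sigma> = word_perm w; (r, s) = last_inversion \<sigma>;
              i = (THE i. i < length w \<and> swapped w i = {\<sigma> r, \<sigma> s})
          in Option.bind (little_bump w i) LS)"

end

theory Submission imports Defs begin

text \<open>
  Read a tableau as the word of its rows, each row from right to left. Then the insertion of \<open>x\<close>
  into a row either does nothing to the word, when \<open>x\<close> exceeds the last entry, or it is a sequence
  of Coxeter--Knuth moves at all consecutive positions of the row. Which of the two happens is
  decided by comparing adjacent letters, and the outcome of a Coxeter--Knuth move is determined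
  by its position. A Little bump preserves the descents of a reduced word and commutes with
  Coxeter--Knuth moves, which is a finite check on triples of letters. Hence the insertions of a
  word and of its bump run in parallel, all their tableaux have the same shapes, and \<open>Q\<close> does not
  change. On Grassmannian words insertion pushes whole columns down, and \<open>Q\<close> agrees with \<open>Tab\<close>
  letter by letter. The Little map terminates because a step never increases the distance between
  the first and the last descent, and if it keeps that distance, then the last descent is involved
  in fewer inversions.
\<close>

section \<open>Permutations of words and their crossings\<close>

text \<open>The obstacle is that the bumps of two Coxeter--Knuth related words do not run in step:
  inside the window of the move one may need two decrements where the other needs one, and a
  commutation may turn into a braid relation. What stays comparable is the word without its marked
  letter. Its permutation is constant along a bump, it can be kept equal for related words, and
  together with the permutation of the whole word it determines the pair of values at the mark. So
  marks are matched by these permutations and not by their positions. The same invariant controls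
  the outcome of a bump: the final permutation is that of the word without its mark times one
  transposition, a cover by the count of inversions, and this drives the termination of the Little
  map. The other obstacle is the shift when a letter 1 is decremented. Admitting the letter 0 turns
  every step into a plain decrement, so the sum of the letters is a measure; one shift at the end,
  which changes neither \<open>EG_Q\<close> nor the termination measures, restores
  positivity.\<close>

lemma transpose_inj_conj: "inj f \<Longrightarrow> transpose (f a) (f b) (f x) = f (transpose a b x)"
  by (auto simp: transpose_def inj_eq)

lemma word_perm_append: "word_perm (u @ v) = word_perm u \<circ> word_perm v"
  by (induction u) (auto simp: fun_eq_iff)

lemma word_perm_rev_cancel [simp]: "word_perm (rev u) (word_perm u i) = i"
  by (induction u arbitrary: i) (auto simp: word_perm_append)

lemma word_perm_cancel_rev [simp]: "word_perm u (word_perm (rev u) i) = i"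
  using word_perm_rev_cancel[of "rev u" i] by simp

lemma inj_word_perm [simp]: "inj (word_perm u)"
  by (metis injI word_perm_rev_cancel)

lemma word_perm_eq_iff [simp]: "word_perm u i = word_perm u j \<longleftrightarrow> i = j"
  by (simp add: inj_eq)

lemma word_perm_fixes_large: "\<exists>N. \<forall>i\<ge>N. word_perm w i = i"
proof (induction w)
  case (Cons k w)
  then obtain N where N: "\<forall>i\<ge>N. word_perm w i = i" by blast
  show ?case by (rule exI[of _ "max N (k + 2)"]) (use N in \<open>auto simp: transpose_def\<close>)
qed auto

lemma word_perm_0: "0 \<notin> set w \<Longrightarrow> word_perm w 0 = 0"
  by (induction w) (auto simp: transpose_def)

lemma word_perm_map_Suc: "word_perm (map Suc w) (Suc i) = Suc (word_perm w i)"
  by (induction w) (auto simp: transpose_def)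

lemma swapped_Cons_0 [simp]: "swapped (k # w) 0 = {k, Suc k}"
  by (simp add: swapped_def)

lemma swapped_Cons_Suc [simp]: "swapped (k # w) (Suc p) = transpose k (Suc k) ` swapped w p"
  by (simp add: swapped_def)

lemma swapped_append1: "p < length u \<Longrightarrow> swapped (u @ v) p = swapped u p"
  by (simp add: swapped_def nth_append)

lemma swapped_append2: "swapped (u @ v) (length u + p) = word_perm u ` swapped v p"
  by (simp add: swapped_def word_perm_append)

lemma swapped_append_mid [simp]:
  "swapped (u @ k # v) (length u) = {word_perm u k, word_perm u (Suc k)}"
  using swapped_append2[of u "k # v" 0] by simp

lemma swapped_append3:
  "swapped (u @ k # v) (Suc (length u + p)) = word_perm u ` transpose k (Suc k) ` swapped v p"
  using swapped_append2[of u "k # v" "Suc p"] by simp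

lemma swapped_map_Suc: "p < length w \<Longrightarrow> swapped (map Suc w) p = Suc ` swapped w p"
  by (simp add: swapped_def word_perm_map_Suc take_map)

lemma swapped_pair: "\<exists>x y. x < y \<and> swapped w p = {x, y}"
proof -
  define i where "i = word_perm (take p w) (w ! p)"
  define j where "j = word_perm (take p w) (Suc (w ! p))"
  have "i \<noteq> j" by (simp add: i_def j_def)
  moreover have "swapped w p = {i, j}" by (simp add: swapped_def i_def j_def)
  ultimately show ?thesis by (metis insert_commute linorder_neqE_nat)
qed

text \<open>
  As \<^term>\<open>word_perm (rev w)\<close> is the inverse of \<^term>\<open>word_perm w\<close>, it maps the left end of a
  wire in the wiring diagram of \<open>w\<close> to its right end.
\<close>

lemma not_swapped_mono:
  assumes "\<And>p. p < length w \<Longrightarrow> swapped w p \<noteq> {x, y}" "x < y"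
  shows "word_perm (rev w) x < word_perm (rev w) y"
  using assms
proof (induction w arbitrary: x y)
  case (Cons k w)
  let ?t = "transpose k (Suc k)"
  have ne: "{k, Suc k} \<noteq> {x, y}" using Cons.prems(1)[of 0] by simp
  have lt: "?t x < ?t y"
    using ne Cons.prems(2) by (auto simp: transpose_def doubleton_eq_iff split: if_splits)
  have "swapped w p \<noteq> {?t x, ?t y}" if "p < length w" for p
  proof
    assume "swapped w p = {?t x, ?t y}"
    then have "swapped (k # w) (Suc p) = {x, y}" by simp
    then show False using Cons.prems(1)[of "Suc p"] that by simp
  qed
  from Cons.IH[OF this lt] show ?case by (simp add: word_perm_append)
qed auto

text \<open>Neither the letters before \<open>p\<close> nor those after it exchange the two wires,
  so they meet at \<open>p\<close> in their original order and leave it for good in the opposite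
  one.\<close>

lemma swapped_once_inverted:
  assumes "p < length w" "swapped w p = {x, y}" "x < y"
    and "\<And>q. q < length w \<Longrightarrow> q \<noteq> p \<Longrightarrow> swapped w q \<noteq> {x, y}"
  shows "word_perm (rev w) y < word_perm (rev w) x"
proof -
  define a k b where "a = take p w" and "k = w ! p" and "b = drop (Suc p) w"
  have w: "w = a @ k # b" and p: "p = length a"
    using assms(1) by (simp_all add: a_def k_def b_def id_take_nth_drop[symmetric])
  have "swapped a q \<noteq> {x, y}" if "q < length a" for q
    using assms(4)[of q] that by (simp add: w p swapped_append1)
  from not_swapped_mono[OF this assms(3)] have lt: "word_perm (rev a) x < word_perm (rev a) y" by simp
  have eq: "{word_perm a k, word_perm a (Suc k)} = {x, y}" using assms(2) by (simp add: w p)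
  then have x: "x = word_perm a k" and y: "y = word_perm a (Suc k)"
    using lt by (auto simp: doubleton_eq_iff)
  have "swapped b q \<noteq> {k, Suc k}" if "q < length b" for q
  proof
    assume "swapped b q = {k, Suc k}"
    then have "swapped w (Suc (length a + q)) = {x, y}"
      by (simp add: w swapped_append3 x y insert_commute)
    then show False using assms(4)[of "Suc (length a + q)"] that by (simp add: w p)
  qed
  from not_swapped_mono[OF this] have "word_perm (rev b) k < word_perm (rev b) (Suc k)" by simp
  then show ?thesis
    by (simp add: w word_perm_append x y)
qed

section \<open>Inversions and reducedness\<close>

text \<open>Position 0 counts, in contrast to \<open>inversions\<close>, because a word with the
  letter 0 moves it.\<close>

definition inv_pairs :: "(nat \<Rightarrow> nat) \<Rightarrow> (nat \<times> nat) set" where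
  "inv_pairs f = {(r, s). r < s \<and> f s < f r}"

lemma inversions_eq_inv_pairs: "f 0 = 0 \<Longrightarrow> inversions f = inv_pairs f"
  unfolding inversions_def inv_pairs_def by (auto simp: Suc_le_eq intro: gr0I)

lemma finite_inv_pairs:
  assumes fixed: "\<forall>i\<ge>N. f i = i"
  shows "finite (inv_pairs f)"
proof -
  define M where "M = N + Max (f ` {..N})"
  have bd: "f i \<le> M" if "i \<le> N" for i
  proof -
    have "f i \<le> Max (f ` {..N})" using that by (intro Max_ge) auto
    then show ?thesis by (simp add: M_def)
  qed
  have "r \<le> M \<and> s \<le> M" if rs: "r < s" "f s < f r" for r s
  proof -
    have "r < N"
    proof (rule ccontr)
      assume "\<not> r < N"
      then have "f r = r" "f s = s" using fixed rs(1) by auto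
      then show False using rs by simp
    qed
    then have "f r \<le> M" using bd by simp
    have "s \<le> M"
    proof (cases "s < N")
      case False
      then have "f s = s" using fixed by simp
      then show ?thesis using rs(2) \<open>f r \<le> M\<close> by simp
    qed (simp add: M_def)
    then show ?thesis using rs(1) by simp
  qed
  then have "inv_pairs f \<subseteq> {..M} \<times> {..M}" by (auto simp: inv_pairs_def)
  then show ?thesis by (rule finite_subset) simp
qed

lemma finite_inv_pairs_word_perm [simp]: "finite (inv_pairs (word_perm w))"
  using word_perm_fixes_large finite_inv_pairs by blast

text \<open>
  A word all of whose crossings are different. Unlike \<^const>\<open>reduced\<close> this allows the letter 0,
  which makes it invariant under shifts and lets a Little bump be computed by decrements alone.
\<close>

definition red :: "nat list \<Rightarrow> bool" where
  "red w \<longleftrightarrow> inj_on (swapped w) {..<length w}"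

lemma redD: "red w \<Longrightarrow> p < length w \<Longrightarrow> q < length w \<Longrightarrow> swapped w p = swapped w q \<Longrightarrow> p = q"
  unfolding red_def inj_on_def by blast

lemma inversion_swapped:
  assumes "(r, s) \<in> inv_pairs (word_perm w)"
  shows "\<exists>p<length w. swapped w p = {word_perm w r, word_perm w s}"
proof (rule ccontr)
  assume "\<not> ?thesis"
  then have "\<And>p. p < length w \<Longrightarrow> swapped w p \<noteq> {word_perm w s, word_perm w r}"
    by (metis insert_commute)
  from not_swapped_mono[OF this] assms show False by (auto simp: inv_pairs_def)
qed

lemma inj_on_inv_pairs: "inj f \<Longrightarrow> inj_on (\<lambda>(r, s). {f r, f s}) (inv_pairs f)"
  unfolding inj_on_def by (auto simp: inv_pairs_def doubleton_eq_iff inj_eq)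

lemma inv_pairs_image_subset:
  "(\<lambda>(r, s). {word_perm w r, word_perm w s}) ` inv_pairs (word_perm w) \<subseteq> swapped w ` {..<length w}"
  using inversion_swapped by fastforce

lemma card_inv_pairs_word_perm_eq:
  "card (inv_pairs (word_perm w)) = card ((\<lambda>(r, s). {word_perm w r, word_perm w s}) ` inv_pairs (word_perm w))"
  by (simp add: card_image inj_on_inv_pairs)

lemma card_inv_pairs_le_swapped: "card (inv_pairs (word_perm w)) \<le> card (swapped w ` {..<length w})"
  unfolding card_inv_pairs_word_perm_eq by (rule card_mono[OF _ inv_pairs_image_subset]) simp

lemma card_inv_pairs_le: "card (inv_pairs (word_perm w)) \<le> length w"
  using card_inv_pairs_le_swapped[of w] card_image_le[of "{..<length w}" "swapped w"] by simp

text \<open>The value pairs of the inversions lie among the swapped pairs, of which there are at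
  most \<open>length w\<close>. If all crossings differ, \<open>swapped_once_inverted\<close> makes
  the two sets equal; conversely, \<open>length w\<close> inversions leave no room for a repeated
  pair.\<close>

lemma red_iff_card: "red w \<longleftrightarrow> card (inv_pairs (word_perm w)) = length w"
proof
  assume r: "red w"
  have "swapped w p \<in> (\<lambda>(r, s). {word_perm w r, word_perm w s}) ` inv_pairs (word_perm w)"
    if p: "p < length w" for p
  proof -
    obtain x y where xy: "x < y" "swapped w p = {x, y}" using swapped_pair by blast
    have "swapped w q \<noteq> {x, y}" if "q < length w" "q \<noteq> p" for q
      using redD[OF r p that(1)] that xy by auto
    from swapped_once_inverted[OF p xy(2,1) this] xy(1)
    have "(word_perm (rev w) y, word_perm (rev w) x) \<in> inv_pairs (word_perm w)"
      by (simp add: inv_pairs_def)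
    then have "(\<lambda>(r, s). {word_perm w r, word_perm w s}) (word_perm (rev w) y, word_perm (rev w) x) \<in> (\<lambda>(r, s). {word_perm w r, word_perm w s}) ` inv_pairs (word_perm w)"
      by (rule imageI)
    then show ?thesis using xy by (simp add: insert_commute)
  qed
  then have "swapped w ` {..<length w} = (\<lambda>(r, s). {word_perm w r, word_perm w s}) ` inv_pairs (word_perm w)"
    using inv_pairs_image_subset[of w] by (intro subset_antisym image_subsetI) auto
  moreover have "card (swapped w ` {..<length w}) = length w"
    using r by (simp add: red_def card_image)
  ultimately show "card (inv_pairs (word_perm w)) = length w"
    by (simp add: card_inv_pairs_word_perm_eq)
next
  assume "card (inv_pairs (word_perm w)) = length w"
  then have "card (swapped w ` {..<length w}) = card {..<length w}"
    using card_inv_pairs_le_swapped[of w] card_image_le[of "{..<length w}" "swapped w"] by simp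
  then show "red w" unfolding red_def by (intro eq_card_imp_inj_on) auto
qed

lemma reduced_iff_red: "reduced w \<longleftrightarrow> 0 \<notin> set w \<and> red w"
proof (cases "0 \<in> set w")
  case False
  then show ?thesis
    by (auto simp: reduced_def red_iff_card inversions_eq_inv_pairs word_perm_0 Suc_le_eq)
      (metis not_gr_zero)
qed (auto simp: reduced_def)

lemma red_map_Suc [simp]: "red (map Suc w) = red w"
proof -
  have "inj_on (swapped (map Suc w)) {..<length w} = inj_on (\<lambda>p. Suc ` swapped w p) {..<length w}"
    by (rule inj_on_cong) (simp add: swapped_map_Suc)
  also have "\<dots> = inj_on (swapped w) {..<length w}"
    by (simp add: inj_on_def inj_image_eq_iff)
  finally show ?thesis by (simp add: red_def)
qed

text \<open>Carries reducedness along Coxeter--Knuth moves and from one mark of a bump to the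
  next.\<close>

lemma red_same_perm: "word_perm u = word_perm v \<Longrightarrow> length u = length v \<Longrightarrow> red u = red v"
  by (simp add: red_iff_card)

lemma red_append1:
  assumes "red (u @ v)" shows "red u"
  unfolding red_def
proof (rule inj_onI)
  fix p q assume "p \<in> {..<length u}" "q \<in> {..<length u}" "swapped u p = swapped u q"
  then show "p = q" using redD[OF assms, of p q] by (simp add: swapped_append1)
qed

lemma red_append2:
  assumes "red (u @ v)" shows "red v"
  unfolding red_def
proof (rule inj_onI)
  fix p q assume "p \<in> {..<length v}" "q \<in> {..<length v}" "swapped v p = swapped v q"
  then show "p = q" using redD[OF assms, of "length u + p" "length u + q"] by (simp add: swapped_append2)
qed

text \<open>The front letter already swaps these two values, so the rest of the word must
  not.\<close>

lemma red_Cons_ascent: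
  assumes "red (k # u)" shows "word_perm (rev u) k < word_perm (rev u) (Suc k)"
proof (rule not_swapped_mono)
  fix p assume p: "p < length u"
  show "swapped u p \<noteq> {k, Suc k}"
  proof
    assume "swapped u p = {k, Suc k}"
    then have "swapped (k # u) (Suc p) = swapped (k # u) 0" by (auto simp: insert_commute)
    then show False using redD[OF assms, of "Suc p" 0] p by simp
  qed
qed simp

subsection \<open>Multiplication by a transposition\<close>

text \<open>An injection from the inversions of \<open>f\<close> to those of \<open>f \<circ> transpose i j\<close>.\<close>

definition pair_swap :: "nat \<Rightarrow> nat \<Rightarrow> nat \<times> nat \<Rightarrow> nat \<times> nat" where
  "pair_swap i j = (\<lambda>(r, s). if transpose i j r < transpose i j s then (transpose i j r, transpose i j s) else (r, s))"

lemma inj_on_pair_swap: "inj_on (pair_swap i j) {(r, s). r < s}"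
proof (rule inj_on_inverseI[of _ "pair_swap i j"])
  fix x assume "x \<in> {(r::nat, s). r < s}"
  then show "pair_swap i j (pair_swap i j x) = x"
    by (cases x) (simp add: pair_swap_def)
qed

text \<open>The delicate inversions are those with one end \<open>i\<close> or \<open>j\<close> and
  the other strictly between: \<open>pair_swap\<close> leaves them in place, and \<open>cov\<close>
  keeps them inverted.\<close>

lemma pair_swap_mem:
  assumes "i < j" "(r, s) \<in> inv_pairs f" "(r, s) \<noteq> (i, j)"
    and cov: "f i < f j \<or> (\<forall>k. i < k \<longrightarrow> k < j \<longrightarrow> f k < f j \<or> f i < f k)"
  shows "pair_swap i j (r, s) \<in> inv_pairs (f \<circ> transpose i j) - {(i, j)}"
proof -
  have rs: "r < s" "f s < f r" using assms(2) by (auto simp: inv_pairs_def)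
  consider "r = i" "s \<noteq> j" "s \<noteq> i" | "r = j" "s \<noteq> j" "s \<noteq> i" | "s = i" "r \<noteq> i" "r \<noteq> j" | "s = j" "r \<noteq> i" "r \<noteq> j"
    | "r \<noteq> i" "r \<noteq> j" "s \<noteq> i" "s \<noteq> j" using rs assms by fastforce
  then show ?thesis
  proof cases
    case 1
    show ?thesis
    proof (cases "j < s")
      case True
      then show ?thesis using 1 rs assms(1) by (simp add: pair_swap_def inv_pairs_def)
    next
      case False
      then have "f s < f j" using cov 1 rs by (metis linorder_neqE_nat order.strict_trans not_less_iff_gr_or_eq)
      then show ?thesis using 1 rs assms(1) False by (simp add: pair_swap_def inv_pairs_def)
    qed
  next
    case 2
    then show ?thesis using rs assms(1) by (simp add: pair_swap_def inv_pairs_def)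
  next
    case 3
    then show ?thesis using rs assms(1) by (simp add: pair_swap_def inv_pairs_def)
  next
    case 4
    show ?thesis
    proof (cases "r < i")
      case True
      then show ?thesis using 4 rs assms(1) by (simp add: pair_swap_def inv_pairs_def)
    next
      case False
      then have "f i < f r" using cov 4 rs
        by (metis linorder_neqE_nat order.strict_trans not_less_iff_gr_or_eq)
      then show ?thesis using 4 rs assms(1) False by (simp add: pair_swap_def inv_pairs_def)
    qed
  next
    case 5
    then show ?thesis using rs by (simp add: pair_swap_def inv_pairs_def)
  qed
qed

lemma inj_on_pair_swap_inv_pairs: "inj_on (pair_swap i j) (inv_pairs f)"
  by (rule inj_on_subset[OF inj_on_pair_swap]) (auto simp: inv_pairs_def)

lemma card_inv_pairs_transpose_gt:
  assumes "finite (inv_pairs (f \<circ> transpose i j))" "i < j" "f i < f j"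
  shows "card (inv_pairs f) < card (inv_pairs (f \<circ> transpose i j))"
proof -
  have "(i, j) \<in> inv_pairs (f \<circ> transpose i j)" using assms by (simp add: inv_pairs_def)
  moreover have "card (inv_pairs f) \<le> card (inv_pairs (f \<circ> transpose i j) - {(i, j)})"
  proof (rule card_inj_on_le[OF inj_on_pair_swap_inv_pairs])
    show "pair_swap i j ` inv_pairs f \<subseteq> inv_pairs (f \<circ> transpose i j) - {(i, j)}"
    proof (intro image_subsetI, clarify)
      fix r s assume rs: "(r, s) \<in> inv_pairs f"
      then have "(r, s) \<noteq> (i, j)" using assms(3) by (auto simp: inv_pairs_def)
      then show "pair_swap i j (r, s) \<in> inv_pairs (f \<circ> transpose i j) - {(i, j)}"
        using pair_swap_mem assms(2,3) rs by blast
    qed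
  qed (use assms in auto)
  ultimately show ?thesis using assms(1)
    by (metis card_Diff1_less order_le_less_trans)
qed

text \<open>The injection misses \<open>(i, k)\<close> as well as \<open>(i, j)\<close>: the only
  candidates for a preimage, \<open>(i, k)\<close> and \<open>(j, k)\<close>, are no inversions of
  \<open>f\<close>.\<close>

lemma card_inv_pairs_transpose_gt2:
  assumes fin: "finite (inv_pairs (f \<circ> transpose i j))" and "i < k" "k < j" "f i < f k" "f k < f j"
  shows "card (inv_pairs f) + 2 \<le> card (inv_pairs (f \<circ> transpose i j))"
proof -
  let ?A = "inv_pairs (f \<circ> transpose i j)"
  have ij: "i < j" "f i < f j" using assms by simp_all
  have m: "(i, j) \<in> ?A" "(i, k) \<in> ?A" using assms ij by (simp_all add: inv_pairs_def)
  have "card (inv_pairs f) \<le> card (?A - {(i, j), (i, k)})"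
  proof (rule card_inj_on_le[OF inj_on_pair_swap_inv_pairs])
    show "pair_swap i j ` inv_pairs f \<subseteq> ?A - {(i, j), (i, k)}"
    proof (intro image_subsetI, clarify)
      fix r s assume rs: "(r, s) \<in> inv_pairs f"
      then have lt: "r < s" "f s < f r" by (auto simp: inv_pairs_def)
      have ne: "(r, s) \<noteq> (i, j)" using lt ij by auto
      have "pair_swap i j (r, s) \<noteq> (i, k)"
      proof
        assume eq: "pair_swap i j (r, s) = (i, k)"
        then have "(r, s) = (i, k) \<or> transpose i j r = i \<and> transpose i j s = k"
          by (auto simp: pair_swap_def split: if_splits)
        then have "(r, s) = (i, k) \<or> (r, s) = (j, k)"
          using assms by (auto simp: transpose_eq_iff)
        then show False using lt assms by auto
      qed
      moreover have "pair_swap i j (r, s) \<in> ?A - {(i, j)}"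
        using pair_swap_mem[OF ij(1) rs ne] ij(2) by blast
      ultimately show "pair_swap i j (r, s) \<in> ?A - {(i, j), (i, k)}" by blast
    qed
  qed (use fin in auto)
  moreover have "card (?A - {(i, j), (i, k)}) = card ?A - 2"
    using m assms by (subst card_Diff_subset) auto
  moreover have "2 \<le> card ?A"
  proof -
    have "card {(i, j), (i, k)} \<le> card ?A" using m fin by (intro card_mono) auto
    then show ?thesis using assms by simp
  qed
  ultimately show ?thesis by linarith
qed

text \<open>This is the cover condition of the Bruhat order: apart from \<open>(i, j)\<close>
  itself, no inversion is lost under \<open>pair_swap\<close>.\<close>

lemma card_inv_pairs_cover:
  assumes fin: "finite (inv_pairs f)" "finite (inv_pairs (f \<circ> transpose i j))" and "i < j"
    and cov: "\<And>k. i < k \<Longrightarrow> k < j \<Longrightarrow> f k < f j \<or> f i < f k"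
  shows "card (inv_pairs f) \<le> Suc (card (inv_pairs (f \<circ> transpose i j)))"
proof -
  have "card (inv_pairs f - {(i, j)}) \<le> card (inv_pairs (f \<circ> transpose i j))"
  proof (rule card_inj_on_le)
    show "inj_on (pair_swap i j) (inv_pairs f - {(i, j)})"
      by (rule inj_on_subset[OF inj_on_pair_swap_inv_pairs]) auto
    show "pair_swap i j ` (inv_pairs f - {(i, j)}) \<subseteq> inv_pairs (f \<circ> transpose i j)"
    proof (intro image_subsetI)
      fix x assume x: "x \<in> inv_pairs f - {(i, j)}"
      obtain r s where rs: "x = (r, s)" by fastforce
      show "pair_swap i j x \<in> inv_pairs (f \<circ> transpose i j)"
        using pair_swap_mem[OF assms(3), of r s f] cov x rs by auto
    qed
  qed (use fin in auto)
  moreover have "card (inv_pairs f) \<le> Suc (card (inv_pairs f - {(i, j)}))"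
    using fin(1) by (cases "(i, j) \<in> inv_pairs f") (simp_all add: card_Suc_Diff1)
  ultimately show ?thesis by linarith
qed

section \<open>Little bumps\<close>

definition del :: "nat \<Rightarrow> 'a list \<Rightarrow> 'a list" where
  "del p u = take p u @ drop (Suc p) u"

definition dec :: "nat list \<Rightarrow> nat \<Rightarrow> nat list" where
  "dec u p = u[p := u ! p - 1]"

lemma del_append_mid [simp]: "del (length a) (a @ k # b) = a @ b"
  by (simp add: del_def)

lemma length_del [simp]: "p < length u \<Longrightarrow> length (del p u) = length u - 1"
  by (simp add: del_def)

lemma length_dec [simp]: "length (dec u p) = length u"
  by (simp add: dec_def)

lemma del_dec [simp]: "del p (dec u p) = del p u"
  by (simp add: del_def dec_def)

section \<open>Deleting a letter, and conflicts between crossings\<close>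

lemma split_at_index:
  assumes "p < length u"
  obtains a k b where "u = a @ k # b" "p = length a"
  using assms id_take_nth_drop[OF assms] by (metis length_take min.absorb4)

text \<open>Moving the letter to the front conjugates it by the prefix, which yields the
  transposition of the two values it swaps.\<close>

lemma word_perm_del:
  assumes "p < length u" "swapped u p = {x, y}"
  shows "word_perm u = transpose x y \<circ> word_perm (del p u)"
proof -
  obtain a k b where u: "u = a @ k # b" "p = length a" using split_at_index assms(1) .
  have "{word_perm a k, word_perm a (Suc k)} = {x, y}" using assms(2) by (simp add: u)
  then have "transpose x y = transpose (word_perm a k) (word_perm a (Suc k))"
    by (auto simp: doubleton_eq_iff transpose_commute)
  then show ?thesis
    by (simp add: u fun_eq_iff word_perm_append transpose_inj_conj)
qed

lemma swapped_del_before: "q < p \<Longrightarrow> p < length u \<Longrightarrow> swapped (del p u) q = swapped u q"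
  by (simp add: del_def swapped_def nth_append)

text \<open>Behind the removed crossing the two wires run on with exchanged names.\<close>

lemma swapped_del_after:
  assumes "p < length u" "swapped u p = {x, y}" "p < q"
  shows "swapped (del p u) (q - 1) = transpose x y ` swapped u q"
proof -
  obtain a k b where u: "u = a @ k # b" "p = length a" using split_at_index assms(1) .
  obtain i where q: "q = Suc (length a + i)"
    using assms(3) u(2) by (metis less_iff_Suc_add)
  have "{word_perm a k, word_perm a (Suc k)} = {x, y}" using assms(2) by (simp add: u)
  then have t: "transpose x y = transpose (word_perm a k) (word_perm a (Suc k))"
    by (auto simp: doubleton_eq_iff transpose_commute)
  have "swapped u q = word_perm a ` transpose k (Suc k) ` swapped b i"
    unfolding u(1) q by (rule swapped_append3)
  moreover have "swapped (del p u) (q - 1) = word_perm a ` swapped b i"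
    using swapped_append2[of a b i] by (simp add: u q)
  ultimately show ?thesis by (simp add: t image_image transpose_inj_conj)
qed

lemma swapped_pair_obtain:
  obtains x y where "x < y" "swapped w p = {x, y}"
  using swapped_pair by blast

lemma swapped_del_same:
  assumes "p < length u" "q < length u" "q \<noteq> p" "swapped u q = swapped u p"
  shows "swapped (del p u) (if q < p then q else q - 1) = swapped u p"
proof -
  obtain x y where xy: "swapped u p = {x, y}" by (rule swapped_pair_obtain)
  show ?thesis
    using assms xy swapped_del_before[of q p u] swapped_del_after[of p u x y q]
    by (auto simp: insert_commute)
qed

lemma transpose_image_pair: "transpose x y ` S = {x, y} \<longleftrightarrow> S = {x, y}"
proof
  assume "transpose x y ` S = {x, y}"
  then have "transpose x y ` transpose x y ` S = {x, y}" by (simp add: insert_commute)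
  then show "S = {x, y}" by (simp add: image_image)
qed (simp add: insert_commute)

lemma adjacent_pair_order:
  assumes "{word_perm b l, word_perm b (Suc l)} = {k, Suc k}"
    and "word_perm (rev b) k < word_perm (rev b) (Suc k)"
  shows "word_perm b l = k" "word_perm b (Suc l) = Suc k"
proof -
  have "\<not> (word_perm b l = Suc k \<and> word_perm b (Suc l) = k)"
  proof
    assume "word_perm b l = Suc k \<and> word_perm b (Suc l) = k"
    then have "word_perm (rev b) (Suc k) = l" "word_perm (rev b) k = Suc l" by (metis word_perm_rev_cancel)+
    then show False using assms(2) by simp
  qed
  then show "word_perm b l = k" "word_perm b (Suc l) = Suc k"
    using assms(1) by (auto simp only: doubleton_eq_iff)
qed

text \<open>
  Without a conflict the values swapped at \<open>p\<close> are no inversion of the shorter word, so the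
  letter at \<open>p\<close> increases the number of inversions.
\<close>

lemma conflict_exists:
  assumes p: "p < length u" and r: "red (del p u)" and nr: "\<not> red u"
  shows "\<exists>q<length u. q \<noteq> p \<and> swapped u q = swapped u p"
proof (rule ccontr)
  assume no: "\<not> ?thesis"
  obtain x y where xy: "x < y" "swapped u p = {x, y}" by (rule swapped_pair_obtain)
  let ?d = "del p u"
  have "swapped ?d q \<noteq> {x, y}" if q: "q < length ?d" for q
  proof (cases "q < p")
    case True
    have "swapped u q \<noteq> {x, y}" using no p xy True by (metis less_imp_neq order.strict_trans)
    then show ?thesis using True p by (simp add: swapped_del_before)
  next
    case False
    then have 1: "swapped ?d q = transpose x y ` swapped u (Suc q)"
      using swapped_del_after[OF p xy(2), of "Suc q"] by simp
    have "Suc q < length u" "Suc q \<noteq> p" using p q False by auto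
    then have "swapped u (Suc q) \<noteq> {x, y}" using no xy by metis
    then show ?thesis by (simp add: 1 transpose_image_pair)
  qed
  from not_swapped_mono[OF this xy(1)]
  have lt: "word_perm (rev ?d) x < word_perm (rev ?d) y" .
  have "word_perm u = word_perm ?d \<circ> transpose (word_perm (rev ?d) x) (word_perm (rev ?d) y)"
  proof
    fix i
    have "word_perm u i = transpose x y (word_perm ?d i)" using word_perm_del[OF p xy(2)] by simp
    also have "\<dots> = transpose (word_perm ?d (word_perm (rev ?d) x)) (word_perm ?d (word_perm (rev ?d) y)) (word_perm ?d i)"
      by simp
    also have "\<dots> = word_perm ?d (transpose (word_perm (rev ?d) x) (word_perm (rev ?d) y) i)"
      by (rule transpose_inj_conj) simp
    finally show "word_perm u i = (word_perm ?d \<circ> transpose (word_perm (rev ?d) x) (word_perm (rev ?d) y)) i"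
      by simp
  qed
  then have "card (inv_pairs (word_perm ?d)) < card (inv_pairs (word_perm u))"
    using card_inv_pairs_transpose_gt[of "word_perm ?d"] lt xy(1)
    by (metis finite_inv_pairs_word_perm word_perm_cancel_rev)
  moreover have "card (inv_pairs (word_perm ?d)) = length u - 1" using r p by (simp add: red_iff_card)
  ultimately have "card (inv_pairs (word_perm u)) = length u"
    using card_inv_pairs_le[of u] by simp
  then show False using nr by (simp add: red_iff_card)
qed

text \<open>Two conflicts would both survive the deletion of \<open>p\<close>, as two crossings of
  one pair of values.\<close>

lemma conflict_unique:
  assumes p: "p < length u" and r: "red (del p u)"
    and "q < length u" "q \<noteq> p" "swapped u q = swapped u p"
    and "q' < length u" "q' \<noteq> p" "swapped u q' = swapped u p"
  shows "q = q'"
proof -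
  let ?f = "\<lambda>q. if q < p then q else q - 1"
  have "?f q < length (del p u)" "?f q' < length (del p u)" using assms by auto
  moreover have "swapped (del p u) (?f q) = swapped (del p u) (?f q')"
    using assms swapped_del_same by metis
  ultimately have eq: "?f q = ?f q'" using redD[OF r] by blast
  show ?thesis
  proof (cases "q < p \<longleftrightarrow> q' < p")
    case True
    then show ?thesis using eq assms(4,7) by (auto split: if_splits)
  next
    case False
    then show ?thesis using eq assms(4,7) by (auto split: if_splits)
  qed
qed

lemma conflict_not_red:
  "p < length u \<Longrightarrow> q < length u \<Longrightarrow> q \<noteq> p \<Longrightarrow> swapped u q = swapped u p \<Longrightarrow> \<not> red u"
  by (metis redD)

text \<open>By \<open>word_perm_del\<close>, removing either crossing multiplies by the same
  transposition. Hence moving the mark of a bump preserves the permutation of the word without its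
  mark.\<close>

lemma conflict_del:
  assumes "p < length u" "q < length u" "swapped u q = swapped u p"
  shows "word_perm (del q u) = word_perm (del p u)"
proof -
  obtain x y where xy: "swapped u p = {x, y}" by (rule swapped_pair_obtain)
  have "transpose x y \<circ> word_perm (del q u) = transpose x y \<circ> word_perm (del p u)"
    using word_perm_del[of q u x y] word_perm_del[of p u x y] assms xy by simp
  then have "transpose x y (word_perm (del q u) i) = transpose x y (word_perm (del p u) i)" for i
    by (metis comp_apply)
  then show ?thesis by (intro ext) (rule transpose_eq_imp_eq)
qed

lemma conflict_red_del:
  assumes "p < length u" "q < length u" "swapped u q = swapped u p" "red (del p u)"
  shows "red (del q u)"
  using red_same_perm[OF conflict_del[OF assms(1-3)]] assms by simp

text \<open>
  In a marked word the wires next to the mark are told apart by their right ends: if \<open>i\<close> is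
  the right end of the upper wire at the mark \<open>p\<close>, then it is the right end of the lower wire
  at the conflicting crossing \<open>q\<close>.
\<close>

lemma conflict_lower_wire:
  assumes p: "p < length u" and q: "q < length u" "q \<noteq> p" "swapped u q = swapped u p"
    and r: "red (del p u)" and up: "word_perm (drop (Suc p) u) i = Suc (u ! p)"
  shows "word_perm (drop (Suc q) u) i = u ! q"
proof (cases "p < q")
  case True
  obtain a k d where u: "u = a @ k # d" "p = length a" using split_at_index p .
  have "q - Suc p < length d" using q True by (simp add: u)
  then obtain b l c where d: "d = b @ l # c" "q - Suc p = length b" by (rule split_at_index)
  have ql: "q = Suc (length a + length b)" using d True u by simp
  have "word_perm a ` transpose k (Suc k) ` {word_perm b l, word_perm b (Suc l)} = word_perm a ` {k, Suc k}"
    using q(3) swapped_append3[of a k d "length b"] by (simp add: u ql d)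
  then have "transpose k (Suc k) ` {word_perm b l, word_perm b (Suc l)} = {k, Suc k}"
    by (metis inj_image_eq_iff inj_word_perm)
  then have eq: "{word_perm b l, word_perm b (Suc l)} = {k, Suc k}"
    unfolding transpose_image_pair .
  \<comment> \<open>Both \<open>b\<close> and \<open>l\<close> survive the deletion of
    \<open>p\<close>. As \<open>l\<close> swaps the wires at levels \<open>k\<close> and
    \<open>Suc k\<close>, nothing in \<open>b\<close> does, and they reach \<open>l\<close> in
    order.\<close>
  have "red (b @ [l] @ c)" using r red_append2[of a d] by (simp add: u d)
  then have rb: "red (b @ [l])" using red_append1[of "b @ [l]" c] by simp
  have "swapped b s \<noteq> {k, Suc k}" if "s < length b" for s
    using redD[OF rb, of s "length b"] that eq swapped_append_mid[of b l "[]"] by (auto simp: swapped_append1)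
  then have "word_perm (rev b) k < word_perm (rev b) (Suc k)" by (intro not_swapped_mono) auto
  then have "word_perm b (Suc l) = Suc k" using adjacent_pair_order(2)[OF eq] by simp
  moreover have "word_perm b (transpose l (Suc l) (word_perm c i)) = Suc k"
    using up by (simp add: u d word_perm_append)
  ultimately have "transpose l (Suc l) (word_perm c i) = Suc l" by (metis word_perm_eq_iff)
  then have "word_perm c i = l" by (auto simp: transpose_eq_iff)
  moreover have "drop (Suc q) u = c" "u ! q = l" by (simp_all add: u d ql nth_append)
  ultimately show ?thesis by simp
next
  case False
  then have "q < p" using q by simp
  obtain a l d where u: "u = a @ l # d" "q = length a" using split_at_index q(1) .
  have "p - Suc q < length d" using p \<open>q < p\<close> by (simp add: u)
  then obtain b k c where d: "d = b @ k # c" "p - Suc q = length b" by (rule split_at_index)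
  have pl: "p = Suc (length a + length b)" using d \<open>q < p\<close> u by simp
  have "word_perm a ` transpose l (Suc l) ` {word_perm b k, word_perm b (Suc k)} = word_perm a ` {l, Suc l}"
    using q(3) swapped_append3[of a l d "length b"] by (simp add: u pl d)
  then have "transpose l (Suc l) ` {word_perm b k, word_perm b (Suc k)} = {l, Suc l}"
    by (metis inj_image_eq_iff inj_word_perm)
  then have eq: "{word_perm b k, word_perm b (Suc k)} = {l, Suc l}"
    unfolding transpose_image_pair .
  have "red ((a @ l # b) @ c)"
    using r del_append_mid[of "a @ l # b" k c] by (simp add: u d pl)
  then have "red (l # b)" using red_append1 red_append2 by blast
  then have "word_perm (rev b) l < word_perm (rev b) (Suc l)" by (rule red_Cons_ascent)
  then have "word_perm b k = l" using adjacent_pair_order(1)[OF eq] by simp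
  moreover have "word_perm c i = Suc k" using up by (simp add: u d pl nth_append)
  ultimately have "word_perm d i = l" by (simp add: d word_perm_append)
  then show ?thesis by (simp add: u)
qed

text \<open>
  \<open>bump u p v\<close>: decrementing from position \<open>p\<close> on leads to \<open>v\<close>. A letter may become 0, but then
  the word is \<^const>\<open>red\<close> and the bump stops; the shift that \<^const>\<open>decr\<close> performs at this
  moment is postponed to \<open>unzero\<close>.
\<close>

inductive bump :: "nat list \<Rightarrow> nat \<Rightarrow> nat list \<Rightarrow> bool" where
  stop: "red (dec u p) \<Longrightarrow> bump u p (dec u p)"
| move: "\<not> red (dec u p) \<Longrightarrow> q < length u \<Longrightarrow> q \<noteq> p \<Longrightarrow> swapped (dec u p) q = swapped (dec u p) p
    \<Longrightarrow> bump (dec u p) q v \<Longrightarrow> bump u p v"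

text \<open>The state before each decrement of a bump: \<open>u\<close> need not be reduced, but
  only the mark can be to blame.\<close>

definition marked :: "nat list \<Rightarrow> nat \<Rightarrow> bool" where
  "marked u p \<longleftrightarrow> p < length u \<and> 0 \<notin> set u \<and> red (del p u)"

definition unzero :: "nat list \<Rightarrow> nat list" where
  "unzero v = (if 0 \<in> set v then map Suc v else v)"

lemma decr_eq_unzero: "p < length u \<Longrightarrow> 0 \<notin> set u \<Longrightarrow> decr u p = unzero (dec u p)"
proof -
  assume p: "p < length u" and z: "0 \<notin> set u"
  then have pos: "u ! p \<noteq> 0" by (metis nth_mem)
  show ?thesis
  proof (cases "u ! p = 1")
    case True
    then have "0 \<in> set (dec u p)" using p by (simp add: dec_def set_update_memI)
    then show ?thesis using True by (simp add: decr_def unzero_def dec_def map_update)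
  next
    case False
    then have "0 \<notin> set (dec u p)"
      using z pos set_update_subset_insert[of u p "u ! p - 1"] by (auto simp: dec_def)
    then show ?thesis using False pos by (simp add: decr_def unzero_def dec_def)
  qed
qed

lemma length_unzero [simp]: "length (unzero v) = length v"
  by (simp add: unzero_def)

lemma red_unzero [simp]: "red (unzero v) = red v"
  by (simp add: unzero_def)

lemma reduced_unzero: "reduced (unzero v) \<longleftrightarrow> red v"
  by (auto simp: reduced_iff_red unzero_def)

text \<open>A letter 0 swaps the value 0, which the other letters, being positive, never move. So it
  has no conflict, and by \<open>conflict_exists\<close> the word is \<open>red\<close>.\<close>

lemma marked_dec_pos:
  assumes m: "marked u p" and nr: "\<not> red (dec u p)"
  shows "0 \<notin> set (dec u p)"
proof
  assume z: "0 \<in> set (dec u p)"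
  have p: "p < length u" and zu: "0 \<notin> set u" and r: "red (del p u)" using m by (auto simp: marked_def)
  obtain a k b where u: "u = a @ k # b" "p = length a" using split_at_index p .
  have d: "dec u p = a @ 0 # b" using z zu by (auto simp: u dec_def)
  obtain q where q: "q < length u" "q \<noteq> p" "swapped (dec u p) q = swapped (dec u p) p"
    using conflict_exists[of p "dec u p"] p r nr by auto
  define i where "i = (if q < p then q else q - 1)"
  have "swapped (a @ b) i = swapped (a @ 0 # b) p"
    using swapped_del_same[of p "a @ 0 # b" q] p q unfolding d i_def by (simp add: u)
  then have "0 \<in> swapped (a @ b) i" using zu by (simp add: u word_perm_0)
  moreover have "i < length (a @ b)" using q p by (auto simp: i_def u)
  ultimately have *: "i < length (a @ b) \<and> 0 \<in> swapped (a @ b) i" by simp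
  have zab: "0 \<notin> set (a @ b)" using zu by (simp add: u)
  have "0 \<notin> set (take i (a @ b))" using zab set_take_subset by fast
  then have f: "word_perm (take i (a @ b)) 0 = 0" by (rule word_perm_0)
  have "(a @ b) ! i \<noteq> 0" using zab * nth_mem by metis
  then have "word_perm (take i (a @ b)) ((a @ b) ! i) \<noteq> 0"
    "word_perm (take i (a @ b)) (Suc ((a @ b) ! i)) \<noteq> 0"
    using f by (metis nat.distinct(1) word_perm_eq_iff)+
  then show False using * unfolding swapped_def by auto
qed

lemma marked_step:
  assumes m: "marked u p" and nr: "\<not> red (dec u p)"
  obtains q where "q < length u" "q \<noteq> p" "swapped (dec u p) q = swapped (dec u p) p" "marked (dec u p) q"
    "\<And>q'. q' < length u \<Longrightarrow> q' \<noteq> p \<Longrightarrow> swapped (dec u p) q' = swapped (dec u p) p \<Longrightarrow> q' = q"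
proof -
  have p: "p < length u" and r: "red (del p u)" using m by (auto simp: marked_def)
  obtain q where q: "q < length u" "q \<noteq> p" "swapped (dec u p) q = swapped (dec u p) p"
    using conflict_exists[of p "dec u p"] p r nr by auto
  moreover have "marked (dec u p) q"
    using marked_dec_pos[OF m nr] conflict_red_del[of p "dec u p" q] q p r by (simp add: marked_def)
  moreover have "q' = q" if "q' < length u" "q' \<noteq> p" "swapped (dec u p) q' = swapped (dec u p) p" for q'
    using conflict_unique[of p "dec u p" q' q] p r q that by simp
  ultimately show ?thesis using that by blast
qed

text \<open>The termination measure of bumps; the shift performed by \<open>decr\<close> would spoil
  it.\<close>

lemma sum_list_dec: "marked u p \<Longrightarrow> sum_list (dec u p) < sum_list u"
proof -
  assume m: "marked u p"
  then have p: "p < length u" by (simp add: marked_def)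
  obtain a k b where u: "u = a @ k # b" "p = length a" using split_at_index p .
  have "k \<noteq> 0" using m by (auto simp: marked_def u)
  then show ?thesis by (simp add: u dec_def)
qed

lemma bump_exists: "marked u p \<Longrightarrow> \<exists>v. bump u p v"
proof (induction "sum_list u" arbitrary: u p rule: less_induct)
  case less
  show ?case
  proof (cases "red (dec u p)")
    case False
    then show ?thesis using marked_step[OF less.prems False] less.hyps[OF sum_list_dec[OF less.prems]]
      by (metis bump.move)
  qed (auto intro: bump.stop)
qed

text \<open>By \<open>marked_dec_pos\<close> the computation of \<open>little_bump\<close> can shift
  only in its last step, so a single \<open>unzero\<close> at the end accounts for it.\<close>

lemma bump_little_bump: "bump u p v \<Longrightarrow> marked u p \<Longrightarrow> little_bump u p = Some (unzero v)"
proof (induction rule: bump.induct)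
  case (stop u p)
  then show ?case
    by (subst little_bump.simps) (simp add: Let_def marked_def decr_eq_unzero reduced_unzero)
next
  case (move u p q v)
  have d: "decr u p = dec u p"
    using decr_eq_unzero marked_dec_pos[OF move.prems move.hyps(1)] move.prems
    by (simp add: unzero_def marked_def)
  have mq: "marked (dec u p) q" 
    and uq: "\<And>q'. q' < length u \<Longrightarrow> q' \<noteq> p \<Longrightarrow> swapped (dec u p) q' = swapped (dec u p) p \<Longrightarrow> q' = q"
    using marked_step[OF move.prems move.hyps(1)] move.hyps(2-4) by metis+
  have "(THE q. q < length (dec u p) \<and> q \<noteq> p \<and> swapped (dec u p) q = swapped (dec u p) p) = q"
    using move.hyps(2-4) uq unfolding length_dec by (intro the_equality) blast+
  then have "little_bump (dec u p) (THE q. q < length (dec u p) \<and> q \<noteq> p \<and> swapped (dec u p) q = swapped (dec u p) p)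
      = Some (unzero v)"
    using move.IH[OF mq] by metis
  moreover have "\<not> reduced (dec u p)" using move.hyps(1) by (simp add: reduced_iff_red)
  ultimately show ?case
    by (subst little_bump.simps) (simp only: Let_def d if_False)
qed

lemma bump_length: "bump u p v \<Longrightarrow> length v = length u"
  by (induction rule: bump.induct) auto

lemma bump_red: "bump u p v \<Longrightarrow> red v"
  by (induction rule: bump.induct) auto

text \<open>By \<open>conflict_lower_wire\<close> the wire with right end \<open>r\<close> is the
  lower one at every mark. The last decrement makes it cross the wire just below it, whose right end
  \<open>r'\<close> is smaller because the final word is reduced.\<close>

lemma bump_perm:
  "bump u p v \<Longrightarrow> marked u p \<Longrightarrow> word_perm (drop (Suc p) u) r = u ! p
    \<Longrightarrow> \<exists>r'<r. word_perm v = word_perm (del p u) \<circ> transpose r' r"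
proof (induction rule: bump.induct)
  case (stop u p)
  have p: "p < length u" and z: "0 \<notin> set u" using stop.prems by (auto simp: marked_def)
  obtain a k b where u: "u = a @ k # b" "p = length a" using split_at_index p .
  have k: "k = Suc (k - 1)" using z by (simp add: u)
  have d: "dec u p = a @ (k - 1) # b" by (simp add: u dec_def)
  define r' where "r' = word_perm (rev b) (k - 1)"
  have r: "r = word_perm (rev b) k" using stop.prems(2) by (auto simp: u)
  have "red ((k - 1) # b)" using stop.hyps red_append2 unfolding d by blast
  from red_Cons_ascent[OF this] have "r' < r" using k by (simp add: r r'_def)
  moreover have "word_perm (dec u p) = word_perm (del p u) \<circ> transpose r' r"
  proof
    fix i
    have "transpose (k - 1) k (word_perm b i) = transpose (word_perm b r') (word_perm b r) (word_perm b i)"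
      by (simp add: r r'_def)
    also have "\<dots> = word_perm b (transpose r' r i)" by (rule transpose_inj_conj) simp
    finally have "transpose (k - 1) (Suc (k - 1)) (word_perm b i) = word_perm b (transpose r' r i)"
      using k by simp
    then show "word_perm (dec u p) i = (word_perm (del p u) \<circ> transpose r' r) i"
      unfolding d by (simp add: u word_perm_append)
  qed
  ultimately show ?case by blast
next
  case (move u p q v)
  have p: "p < length u" and z: "0 \<notin> set u" and rd: "red (del p u)"
    using move.prems by (auto simp: marked_def)
  have pos: "u ! p \<noteq> 0" using p z by (metis nth_mem)
  have mq: "marked (dec u p) q" using marked_step[OF move.prems(1) move.hyps(1)] move.hyps(2-4) by metis
  have "word_perm (drop (Suc q) (dec u p)) r = dec u p ! q"
  proof (rule conflict_lower_wire)
    show "word_perm (drop (Suc p) (dec u p)) r = Suc (dec u p ! p)"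
      using move.prems(2) p pos by (simp add: dec_def)
  qed (use move.hyps p rd in simp_all)
  from move.IH[OF mq this] obtain r' where "r' < r" "word_perm v = word_perm (del q (dec u p)) \<circ> transpose r' r"
    by blast
  moreover have "word_perm (del q (dec u p)) = word_perm (del p u)"
    using conflict_del[of p "dec u p" q] p move.hyps by simp
  ultimately show ?case by auto
qed

section \<open>Little bumps and Coxeter--Knuth moves\<close>

lemma dec_append1: "i < length W \<Longrightarrow> dec (W @ \<beta>) i = dec W i @ \<beta>"
  by (simp add: dec_def nth_append list_update_append)

lemma dec_append2: "dec (\<alpha> @ W) (length \<alpha> + i) = \<alpha> @ dec W i"
  by (simp add: dec_def nth_append list_update_append)

lemma dec_factor: "i < length W \<Longrightarrow> dec (\<alpha> @ W @ \<beta>) (length \<alpha> + i) = \<alpha> @ dec W i @ \<beta>"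
  by (simp add: dec_append1 dec_append2)

lemma dec_factor_before: "p < length \<alpha> \<Longrightarrow> dec (\<alpha> @ W @ \<beta>) p = dec \<alpha> p @ W @ \<beta>"
  by (simp add: dec_append1)

lemma dec_factor_after:
  "dec (\<alpha> @ W @ \<beta>) (length \<alpha> + (length W + i)) = \<alpha> @ W @ dec \<beta> i"
  by (simp add: dec_append2)

lemma del_factor: "i < length W \<Longrightarrow> del (length \<alpha> + i) (\<alpha> @ W @ \<beta>) = \<alpha> @ del i W @ \<beta>"
  by (simp add: del_def)

lemma swapped_factor:
  "i < length W \<Longrightarrow> swapped (\<alpha> @ W @ \<beta>) (length \<alpha> + i) = word_perm \<alpha> ` swapped W i"
  by (simp add: swapped_append1 swapped_append2)

text \<open>
  The word \<open>x\<close> has just been decremented at \<open>m\<close>: the bump stops at \<open>x\<close> or continues from the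
  conflicting letter.
\<close>

definition settle :: "nat list \<Rightarrow> nat \<Rightarrow> nat list \<Rightarrow> bool" where
  "settle x m v \<longleftrightarrow> (if red x then v = x
    else \<exists>q<length x. q \<noteq> m \<and> swapped x q = swapped x m \<and> bump x q v)"

text \<open>One or two decrements of a bump. Two suffice in all later uses: when a decrement causes
  a collision inside a window of two or three letters, decrementing the other colliding letter
  repairs the window.\<close>

definition partial_bump :: "nat list \<Rightarrow> nat \<Rightarrow> nat list \<Rightarrow> nat \<Rightarrow> bool" where
  "partial_bump u p x m \<longleftrightarrow> x = dec u p \<and> m = p \<or>
    (\<exists>q<length u. q \<noteq> p \<and> swapped (dec u p) q = swapped (dec u p) p \<and> x = dec (dec u p) q \<and> m = q)"

lemma bump_iff_settle: "bump u p v \<longleftrightarrow> settle (dec u p) p v"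
  unfolding settle_def by (subst bump.simps) auto

lemma partial_bump_factor:
  assumes "partial_bump W i V k" "i < length W"
  shows "partial_bump (\<alpha> @ W @ \<beta>) (length \<alpha> + i) (\<alpha> @ V @ \<beta>) (length \<alpha> + k)"
proof -
  from assms(1) consider "V = dec W i" "k = i"
    | "k < length W" "k \<noteq> i" "swapped (dec W i) k = swapped (dec W i) i" "V = dec (dec W i) k"
    unfolding partial_bump_def by blast
  then show ?thesis
  proof cases
    case 2
    have "swapped (\<alpha> @ dec W i @ \<beta>) (length \<alpha> + k) = swapped (\<alpha> @ dec W i @ \<beta>) (length \<alpha> + i)"
      using 2 assms(2) by (simp add: swapped_factor)
    then show ?thesis unfolding partial_bump_def
      using 2 assms(2) by (intro disjI2 exI[of _ "length \<alpha> + k"]) (simp add: dec_factor)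
  qed (use assms(2) in \<open>simp add: partial_bump_def dec_factor\<close>)
qed

text \<open>Lets inductions over bumps proceed by partial bumps in place of single decrements. As
  the conflict is unique, the second decrement is the one that the bump itself performs.\<close>

lemma partial_bump:
  assumes m: "marked u p" and pb: "partial_bump u p x m"
  shows "bump u p v \<longleftrightarrow> settle x m v" "m < length x" "length x = length u" "red (del m x)"
    "word_perm (del m x) = word_perm (del p u)" "sum_list x < sum_list u" "\<not> red x \<Longrightarrow> 0 \<notin> set x"
proof -
  have p: "p < length u" and r: "red (del p u)" using m by (auto simp: marked_def)
  from pb consider "x = dec u p" "m = p"
    | "m < length u" "m \<noteq> p" "swapped (dec u p) m = swapped (dec u p) p" "x = dec (dec u p) m"
    unfolding partial_bump_def by blast
  then have "(bump u p v \<longleftrightarrow> settle x m v) \<and> m < length x \<and> length x = length u \<and> red (del m x) \<and>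
    word_perm (del m x) = word_perm (del p u) \<and> sum_list x < sum_list u \<and> (\<not> red x \<longrightarrow> 0 \<notin> set x)"
  proof cases
    case 1
    then show ?thesis
      using p r m sum_list_dec[OF m] marked_dec_pos[OF m] by (simp add: bump_iff_settle)
  next
    case 2
    have nr: "\<not> red (dec u p)" using conflict_not_red[of p "dec u p" m] 2 p by simp
    obtain q where q: "q < length u" "q \<noteq> p" "swapped (dec u p) q = swapped (dec u p) p" "marked (dec u p) q"
      "\<And>q'. q' < length u \<Longrightarrow> q' \<noteq> p \<Longrightarrow> swapped (dec u p) q' = swapped (dec u p) p \<Longrightarrow> q' = q"
      using marked_step[OF m nr] by metis
    have mq: "m = q" using q(5) 2(1-3) by blast
    have "bump u p v \<longleftrightarrow> bump (dec u p) q v"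
      using nr q(1-3,5) unfolding bump_iff_settle[of u] settle_def length_dec by (simp only: if_False) metis
    then have "bump u p v \<longleftrightarrow> settle x m v" by (simp add: bump_iff_settle[of _ q] 2(4) mq)
    moreover have "word_perm (del m x) = word_perm (del p u)"
      using conflict_del[of p "dec u p" m] 2 p by simp
    moreover have "red (del m x)" using q(4) by (simp add: 2(4) mq marked_def)
    moreover have "sum_list x < sum_list u"
      using sum_list_dec[OF m] sum_list_dec[OF q(4)] by (simp add: 2(4) mq)
    moreover have "\<not> red x \<Longrightarrow> 0 \<notin> set x" using marked_dec_pos[OF q(4)] by (simp add: 2(4) mq)
    ultimately show ?thesis using 2(1,4) by simp
  qed
  then show "bump u p v \<longleftrightarrow> settle x m v" "m < length x" "length x = length u" "red (del m x)"
    "word_perm (del m x) = word_perm (del p u)" "sum_list x < sum_list u" "\<not> red x \<Longrightarrow> 0 \<notin> set x"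
    by blast+
qed

lemma settle_cases:
  assumes "settle x m v" "m < length x" "red (del m x)" "\<not> red x \<Longrightarrow> 0 \<notin> set x"
  obtains "red x" "v = x" |
    q where "\<not> red x" "q < length x" "q \<noteq> m" "swapped x q = swapped x m" "bump x q v" "marked x q"
proof (cases "red x")
  case False
  then obtain q where q: "q < length x" "q \<noteq> m" "swapped x q = swapped x m" "bump x q v"
    using assms(1) by (auto simp: settle_def)
  have "marked x q" using conflict_red_del[OF assms(2) q(1,3) assms(3)] assms(4) False q(1) by (simp add: marked_def)
  then show ?thesis using that(2) False q by blast
qed (use assms(1) that(1) in \<open>simp add: settle_def\<close>)

subsection \<open>Descents\<close>

lemma swapped_adjacent: "Suc j < length u \<Longrightarrow> u ! j = u ! Suc j \<Longrightarrow> swapped u (Suc j) = swapped u j"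
  by (simp add: swapped_def take_Suc_conv_app_nth word_perm_append insert_commute)

lemma nth_dec: "p < length u \<Longrightarrow> dec u p ! i = (if i = p then u ! p - 1 else u ! i)"
  by (simp add: dec_def)

text \<open>One decrement can disturb the comparison only by making the two letters equal. Equal
  neighbours are in conflict, so the bump next decrements the other one and restores the
  order.\<close>

lemma partial_bump_ascent:
  assumes m: "marked u p" and j: "Suc j < length u" "u ! j \<noteq> u ! Suc j"
  shows "\<exists>x m. partial_bump u p x m \<and> x ! j \<noteq> x ! Suc j \<and> (x ! j < x ! Suc j \<longleftrightarrow> u ! j < u ! Suc j)"
proof -
  have p: "p < length u" and z: "0 \<notin> set u" using m by (auto simp: marked_def)
  have pos: "u ! j \<noteq> 0" "u ! Suc j \<noteq> 0" using z j(1) by (metis Suc_lessD nth_mem)+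
  show ?thesis
  proof (cases "dec u p ! j = dec u p ! Suc j")
    case False
    then have "dec u p ! j \<noteq> dec u p ! Suc j \<and> (dec u p ! j < dec u p ! Suc j \<longleftrightarrow> u ! j < u ! Suc j)"
      using pos j(2) p by (auto simp: nth_dec split: if_splits)
    moreover have "partial_bump u p (dec u p) p" by (simp add: partial_bump_def)
    ultimately show ?thesis by blast
  next
    case True
    define q where "q = (if p = j then Suc j else j)"
    have "p = j \<or> p = Suc j" using True j(2) p by (auto simp: nth_dec split: if_splits)
    then have q: "q < length u" "q \<noteq> p" "swapped (dec u p) q = swapped (dec u p) p"
      using swapped_adjacent[of j "dec u p"] True j(1) by (auto simp: q_def)
    let ?x = "dec (dec u p) q"
    have "partial_bump u p ?x q" using q unfolding partial_bump_def by blast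
    moreover have "?x ! j \<noteq> ?x ! Suc j \<and> (?x ! j < ?x ! Suc j \<longleftrightarrow> u ! j < u ! Suc j)"
      using True \<open>p = j \<or> p = Suc j\<close> pos j p q(1) by (auto simp: nth_dec q_def split: if_splits)
    ultimately show ?thesis by blast
  qed
qed

lemma bump_ascent:
  "marked u p \<Longrightarrow> Suc j < length u \<Longrightarrow> u ! j \<noteq> u ! Suc j \<Longrightarrow> bump u p v
    \<Longrightarrow> v ! j < v ! Suc j \<longleftrightarrow> u ! j < u ! Suc j"
proof (induction "sum_list u" arbitrary: u p rule: less_induct)
  case less
  obtain x m where pb: "partial_bump u p x m"
    and x: "x ! j \<noteq> x ! Suc j" "x ! j < x ! Suc j \<longleftrightarrow> u ! j < u ! Suc j"
    using partial_bump_ascent[OF less.prems(1-3)] by blast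
  note P = partial_bump[OF less.prems(1) pb]
  have "settle x m v" using P(1) less.prems(4) by blast
  then show ?case
  proof (rule settle_cases[OF _ P(2) P(4) P(7)])
    fix q assume "bump x q v" "marked x q"
    then show ?thesis using less.hyps[OF P(6), of q] x less.prems(2) P(3) by simp
  qed (use x in auto)
qed

subsection \<open>Coxeter--Knuth moves\<close>

inductive ck3 :: "nat list \<Rightarrow> nat list \<Rightarrow> bool" where
  "x < y \<Longrightarrow> y < z \<Longrightarrow> ck3 [y, x, z] [y, z, x]"
| "x < y \<Longrightarrow> y < z \<Longrightarrow> ck3 [y, z, x] [y, x, z]"
| "x < y \<Longrightarrow> y < z \<Longrightarrow> ck3 [x, z, y] [z, x, y]"
| "x < y \<Longrightarrow> y < z \<Longrightarrow> ck3 [z, x, y] [x, z, y]"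
| "ck3 [k, Suc k, k] [Suc k, k, Suc k]"
| "ck3 [Suc k, k, Suc k] [k, Suc k, k]"

definition ck_at :: "nat \<Rightarrow> nat list \<Rightarrow> nat list \<Rightarrow> bool" where
  "ck_at j u v \<longleftrightarrow> (\<exists>\<alpha> W W' \<beta>. u = \<alpha> @ W @ \<beta> \<and> v = \<alpha> @ W' @ \<beta> \<and> length \<alpha> = j \<and> ck3 W W')"

lemma ck3_length: "ck3 W W' \<Longrightarrow> length W = 3 \<and> length W' = 3"
  by (erule ck3.cases) auto

lemma ck3_set: "ck3 W W' \<Longrightarrow> set W' = set W"
  by (erule ck3.cases) auto

lemma transpose_Suc_commute:
  "Suc a < b \<Longrightarrow> transpose b (Suc b) (transpose a (Suc a) i) = transpose a (Suc a) (transpose b (Suc b) i)"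
  by (simp add: transpose_def)

lemma transpose_Suc_braid:
  "transpose (Suc k) (Suc (Suc k)) (transpose k (Suc k) (transpose (Suc k) (Suc (Suc k)) i)) =
   transpose k (Suc k) (transpose (Suc k) (Suc (Suc k)) (transpose k (Suc k) i))"
  by (simp add: transpose_def)

lemma ck3_word_perm: "ck3 W W' \<Longrightarrow> word_perm W' = word_perm W"
  by (erule ck3.cases) (auto simp: fun_eq_iff transpose_Suc_commute transpose_Suc_braid)

text \<open>The six left-hand patterns exclude each other, so a word and a position determine the
  result of the move.\<close>

lemma ck3_det: "ck3 W V \<Longrightarrow> ck3 W V' \<Longrightarrow> V = V'"
  by (erule ck3.cases; erule ck3.cases) auto

lemma red_triple:
  assumes "a \<noteq> b" "b \<noteq> c" "c = a \<Longrightarrow> b = Suc a \<or> a = Suc b"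
  shows "red [a, b, c]"
proof -
  have 1: "swapped [a, b, c] 1 \<noteq> swapped [a, b, c] 0"
    using assms(1) by (simp only: One_nat_def swapped_Cons_Suc swapped_Cons_0 transpose_image_pair)
      (auto simp: doubleton_eq_iff)
  have 2: "swapped [a, b, c] 2 \<noteq> swapped [a, b, c] 0"
  proof
    assume "swapped [a, b, c] 2 = swapped [a, b, c] 0"
    then have "transpose a (Suc a) ` transpose b (Suc b) ` {c, Suc c} = {a, Suc a}"
      by (simp only: numeral_2_eq_2 swapped_Cons_Suc swapped_Cons_0)
    then have "{transpose b (Suc b) c, transpose b (Suc b) (Suc c)} = {a, Suc a}"
      unfolding transpose_image_pair by simp
    note eq = this
    consider "c = Suc b" | "b = Suc c" | "c \<noteq> Suc b" "b \<noteq> Suc c" by blast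
    then show False
    proof cases
      case 1
      then show False using eq by (auto simp: doubleton_eq_iff)
    next
      case 2
      then show False using eq by (auto simp: doubleton_eq_iff)
    next
      case 3
      then have "{c, Suc c} = {a, Suc a}" using eq assms(2) by simp
      then have "c = a" by (auto simp: doubleton_eq_iff)
      then show False using 3 assms(3) by auto
    qed
  qed
  have 3: "swapped [a, b, c] 2 \<noteq> swapped [a, b, c] 1"
  proof
    assume "swapped [a, b, c] 2 = swapped [a, b, c] 1"
    then have "transpose a (Suc a) ` transpose b (Suc b) ` {c, Suc c} = transpose a (Suc a) ` {b, Suc b}"
      by (simp only: numeral_2_eq_2 One_nat_def swapped_Cons_Suc swapped_Cons_0)
    then have "transpose b (Suc b) ` {c, Suc c} = {b, Suc b}" by (metis inj_image_eq_iff inj_transpose)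
    then show False using assms(2) unfolding transpose_image_pair by (auto simp: doubleton_eq_iff)
  qed
  have "{..<length [a, b, c]} = {0, 1, 2}" by auto
  then show ?thesis unfolding red_def using 1 2 3 by (simp only: inj_on_insert) force
qed

lemma ck3_red: "ck3 W W' \<Longrightarrow> red W"
  by (erule ck3.cases) (auto intro!: red_triple)

lemma ck_at_length: "ck_at j u v \<Longrightarrow> length v = length u"
  unfolding ck_at_def using ck3_length by fastforce

lemma ck_at_set: "ck_at j u v \<Longrightarrow> set v = set u"
  unfolding ck_at_def using ck3_set by auto

lemma ck_at_word_perm: "ck_at j u v \<Longrightarrow> word_perm v = word_perm u"
  unfolding ck_at_def using ck3_word_perm by (auto simp: word_perm_append)

lemma ck_at_red: "ck_at j u v \<Longrightarrow> red v = red u"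
  by (rule red_same_perm) (simp_all add: ck_at_word_perm ck_at_length)

lemma ck_at_det: "ck_at j u v \<Longrightarrow> ck_at j u v' \<Longrightarrow> v = v'"
proof -
  assume "ck_at j u v" "ck_at j u v'"
  then obtain \<alpha> W V \<beta> \<alpha>' W' V' \<beta>' where u: "u = \<alpha> @ W @ \<beta>" "v = \<alpha> @ V @ \<beta>" "length \<alpha> = j" "ck3 W V"
    and u': "u = \<alpha>' @ W' @ \<beta>'" "v' = \<alpha>' @ V' @ \<beta>'" "length \<alpha>' = j" "ck3 W' V'"
    unfolding ck_at_def by metis
  have "length W = 3" "length W' = 3" using u u' ck3_length by blast+
  then have "\<alpha> = \<alpha>' \<and> W = W' \<and> \<beta> = \<beta>'" using u u' by (metis append_eq_append_conv)
  then show ?thesis using u u' ck3_det by blast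
qed

lemma ck3_sym: "ck3 W W' \<Longrightarrow> ck3 W' W"
  by (erule ck3.cases) (auto intro: ck3.intros)

text \<open>
  Two marks in Coxeter--Knuth related triples that leave the same permutation when deleted: once
  the bump has repaired the triples, by one or two decrements each, they are related again.
\<close>

definition ck_matched :: "nat list \<Rightarrow> nat \<Rightarrow> nat list \<Rightarrow> nat \<Rightarrow> bool" where
  "ck_matched W i W' i' \<longleftrightarrow> word_perm (del i' W') = word_perm (del i W) \<and>
    (\<exists>V k V' k'. partial_bump W i V k \<and> partial_bump W' i' V' k' \<and> k < 3 \<and> k' < 3 \<and> ck3 V V')"

lemma ck_matched_sym: "ck_matched W i W' i' \<Longrightarrow> ck_matched W' i' W i"
  unfolding ck_matched_def by (metis ck3_sym)

lemma ck_matchedI: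
  assumes "word_perm (del i' W') = word_perm (del i W)" "partial_bump W i V k" "partial_bump W' i' V' k'"
    "k < 3" "k' < 3" "ck3 V V'"
  shows "ck_matched W i W' i'"
  using assms unfolding ck_matched_def by blast

lemma partial_bump_single: "dec u p = x \<Longrightarrow> partial_bump u p x p"
  by (auto simp: partial_bump_def)

lemma partial_bump_double:
  "dec u p = y \<Longrightarrow> dec y q = x \<Longrightarrow> q < length u \<Longrightarrow> q \<noteq> p \<Longrightarrow> swapped y q = swapped y p \<Longrightarrow> partial_bump u p x q"
  by (auto simp: partial_bump_def)

lemma swapped_triple_same:
  "swapped [a, a, c] (Suc 0) = swapped [a, a, c] 0"
  "swapped [a, b, b] (Suc (Suc 0)) = swapped [a, b, b] (Suc 0)"
  "Suc a < b \<or> Suc b < a \<Longrightarrow> swapped [a, b, a] (Suc (Suc 0)) = swapped [a, b, a] 0"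
  by (auto simp: transpose_def)

lemma word_perm_pair_commute: "Suc a < b \<Longrightarrow> word_perm [b, a] = word_perm [a, b]"
  by (simp add: fun_eq_iff transpose_Suc_commute)

lemma ck3_iff: "ck3 [a, b, c] [a', b', c'] \<longleftrightarrow>
    (b < a \<and> a < c \<or> c < a \<and> a < b) \<and> a' = a \<and> b' = c \<and> c' = b \<or>
    (a < c \<and> c < b \<or> b < c \<and> c < a) \<and> a' = b \<and> b' = a \<and> c' = c \<or>
    c = a \<and> (b = Suc a \<or> a = Suc b) \<and> a' = b \<and> b' = a \<and> c' = b"
  by (auto intro: ck3.intros elim: ck3.cases)

section \<open>The finite check on marked triples\<close>

text \<open>In these names the number is the marked index of the first triple. In the primed
  variants some decrement meets a neighbouring value, so that at least one of the two bumps needs a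
  second decrement.\<close>

lemma ck_matched_yxz_0:
  assumes ord: "0 < x" "Suc x < y" "y < z"
  shows "ck_matched [y, x, z] 0 [y, z, x] 0"
proof (rule ck_matchedI)
  show "partial_bump [y, x, z] 0 [y - 1, x, z] 0" by (rule partial_bump_single) (use ord in \<open>simp add: dec_def\<close>)
  show "partial_bump [y, z, x] 0 [y - 1, z, x] 0" by (rule partial_bump_single) (use ord in \<open>simp add: dec_def\<close>)
  show "ck3 [y - 1, x, z] [y - 1, z, x]" using ord by (simp add: ck3_iff; linarith)
qed (use ord in \<open>auto simp: del_def word_perm_pair_commute simp del: word_perm.simps\<close>)

lemma ck_matched_yxz_0':
  assumes ord: "0 < x" "Suc x < z"
  shows "ck_matched [Suc x, x, z] 0 [Suc x, z, x] 0"
proof (rule ck_matchedI)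
  show "partial_bump [Suc x, x, z] 0 [x, x - 1, z] (Suc 0)"
    by (rule partial_bump_double[of _ _ "[x, x, z]"]) (use ord in \<open>simp_all add: dec_def swapped_triple_same del: swapped_Cons_0 swapped_Cons_Suc\<close>)
  show "partial_bump [Suc x, z, x] 0 [x, z, x - 1] (Suc (Suc 0))"
    by (rule partial_bump_double[of _ _ "[x, z, x]"]) (use ord in \<open>simp_all add: dec_def swapped_triple_same del: swapped_Cons_0 swapped_Cons_Suc\<close>)
  show "ck3 [x, x - 1, z] [x, z, x - 1]" using ord by (simp add: ck3_iff; linarith)
qed (use ord in \<open>auto simp: del_def word_perm_pair_commute simp del: word_perm.simps\<close>)

lemma ck_matched_yxz_1:
  assumes ord: "0 < x" "x < y" "y < z"
  shows "ck_matched [y, x, z] (Suc 0) [y, z, x] (Suc (Suc 0))"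
proof (rule ck_matchedI)
  show "partial_bump [y, x, z] (Suc 0) [y, x - 1, z] (Suc 0)" by (rule partial_bump_single) (use ord in \<open>simp add: dec_def\<close>)
  show "partial_bump [y, z, x] (Suc (Suc 0)) [y, z, x - 1] (Suc (Suc 0))" by (rule partial_bump_single) (use ord in \<open>simp add: dec_def\<close>)
  show "ck3 [y, x - 1, z] [y, z, x - 1]" using ord by (simp add: ck3_iff; linarith)
qed (use ord in \<open>auto simp: del_def word_perm_pair_commute simp del: word_perm.simps\<close>)

lemma ck_matched_yxz_2:
  assumes ord: "0 < x" "x < y" "Suc y < z"
  shows "ck_matched [y, x, z] (Suc (Suc 0)) [y, z, x] (Suc 0)"
proof (rule ck_matchedI)
  show "partial_bump [y, x, z] (Suc (Suc 0)) [y, x, z - 1] (Suc (Suc 0))" by (rule partial_bump_single) (use ord in \<open>simp add: dec_def\<close>)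
  show "partial_bump [y, z, x] (Suc 0) [y, z - 1, x] (Suc 0)" by (rule partial_bump_single) (use ord in \<open>simp add: dec_def\<close>)
  show "ck3 [y, x, z - 1] [y, z - 1, x]" using ord by (simp add: ck3_iff; linarith)
qed (use ord in \<open>auto simp: del_def word_perm_pair_commute simp del: word_perm.simps\<close>)

lemma ck_matched_yxz_2':
  assumes ord: "0 < x" "Suc x < y"
  shows "ck_matched [y, x, Suc y] (Suc (Suc 0)) [y, Suc y, x] (Suc 0)"
proof (rule ck_matchedI)
  show "partial_bump [y, x, Suc y] (Suc (Suc 0)) [y - 1, x, y] 0"
    by (rule partial_bump_double[of _ _ "[y, x, y]"]) (use ord in \<open>simp_all add: dec_def swapped_triple_same del: swapped_Cons_0 swapped_Cons_Suc\<close>)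
  show "partial_bump [y, Suc y, x] (Suc 0) [y - 1, y, x] 0"
    by (rule partial_bump_double[of _ _ "[y, y, x]"]) (use ord in \<open>simp_all add: dec_def swapped_triple_same del: swapped_Cons_0 swapped_Cons_Suc\<close>)
  show "ck3 [y - 1, x, y] [y - 1, y, x]" using ord by (simp add: ck3_iff; linarith)
qed (use ord in \<open>auto simp: del_def word_perm_pair_commute simp del: word_perm.simps\<close>)

text \<open>On three consecutive letters one bump takes one step and the other two, and the
  commutation becomes a braid relation. The braid lemmas below go the opposite way.\<close>

lemma ck_matched_yxz_2'':
  assumes ord: "0 < x"
  shows "ck_matched [Suc x, x, Suc (Suc x)] (Suc (Suc 0)) [Suc x, Suc (Suc x), x] (Suc 0)"
proof (rule ck_matchedI)
  show "partial_bump [Suc x, x, Suc (Suc x)] (Suc (Suc 0)) [Suc x, x, Suc x] (Suc (Suc 0))" by (rule partial_bump_single) (use ord in \<open>simp add: dec_def\<close>)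
  show "partial_bump [Suc x, Suc (Suc x), x] (Suc 0) [x, Suc x, x] 0"
    by (rule partial_bump_double[of _ _ "[Suc x, Suc x, x]"]) (use ord in \<open>simp_all add: dec_def swapped_triple_same del: swapped_Cons_0 swapped_Cons_Suc\<close>)
  show "ck3 [Suc x, x, Suc x] [x, Suc x, x]" using ord by (simp add: ck3_iff; linarith)
qed (use ord in \<open>auto simp: del_def word_perm_pair_commute simp del: word_perm.simps\<close>)

lemma ck_matched_xzy_0:
  assumes ord: "0 < x" "x < y" "y < z"
  shows "ck_matched [x, z, y] 0 [z, x, y] (Suc 0)"
proof (rule ck_matchedI)
  show "partial_bump [x, z, y] 0 [x - 1, z, y] 0" by (rule partial_bump_single) (use ord in \<open>simp add: dec_def\<close>)
  show "partial_bump [z, x, y] (Suc 0) [z, x - 1, y] (Suc 0)" by (rule partial_bump_single) (use ord in \<open>simp add: dec_def\<close>)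
  show "ck3 [x - 1, z, y] [z, x - 1, y]" using ord by (simp add: ck3_iff; linarith)
qed (use ord in \<open>auto simp: del_def word_perm_pair_commute simp del: word_perm.simps\<close>)

lemma ck_matched_xzy_1:
  assumes ord: "0 < x" "x < y" "Suc y < z"
  shows "ck_matched [x, z, y] (Suc 0) [z, x, y] 0"
proof (rule ck_matchedI)
  show "partial_bump [x, z, y] (Suc 0) [x, z - 1, y] (Suc 0)" by (rule partial_bump_single) (use ord in \<open>simp add: dec_def\<close>)
  show "partial_bump [z, x, y] 0 [z - 1, x, y] 0" by (rule partial_bump_single) (use ord in \<open>simp add: dec_def\<close>)
  show "ck3 [x, z - 1, y] [z - 1, x, y]" using ord by (simp add: ck3_iff; linarith)
qed (use ord in \<open>auto simp: del_def word_perm_pair_commute simp del: word_perm.simps\<close>)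

lemma ck_matched_xzy_1':
  assumes ord: "0 < x" "Suc x < y"
  shows "ck_matched [x, Suc y, y] (Suc 0) [Suc y, x, y] 0"
proof (rule ck_matchedI)
  show "partial_bump [x, Suc y, y] (Suc 0) [x, y, y - 1] (Suc (Suc 0))"
    by (rule partial_bump_double[of _ _ "[x, y, y]"]) (use ord in \<open>simp_all add: dec_def swapped_triple_same del: swapped_Cons_0 swapped_Cons_Suc\<close>)
  show "partial_bump [Suc y, x, y] 0 [y, x, y - 1] (Suc (Suc 0))"
    by (rule partial_bump_double[of _ _ "[y, x, y]"]) (use ord in \<open>simp_all add: dec_def swapped_triple_same del: swapped_Cons_0 swapped_Cons_Suc\<close>)
  show "ck3 [x, y, y - 1] [y, x, y - 1]" using ord by (simp add: ck3_iff; linarith)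
qed (use ord in \<open>auto simp: del_def word_perm_pair_commute simp del: word_perm.simps\<close>)

lemma ck_matched_xzy_1'':
  assumes ord: "0 < x"
  shows "ck_matched [x, Suc (Suc x), Suc x] (Suc 0) [Suc (Suc x), x, Suc x] 0"
proof (rule ck_matchedI)
  show "partial_bump [x, Suc (Suc x), Suc x] (Suc 0) [x, Suc x, x] (Suc (Suc 0))"
    by (rule partial_bump_double[of _ _ "[x, Suc x, Suc x]"]) (use ord in \<open>simp_all add: dec_def swapped_triple_same del: swapped_Cons_0 swapped_Cons_Suc\<close>)
  show "partial_bump [Suc (Suc x), x, Suc x] 0 [Suc x, x, Suc x] 0" by (rule partial_bump_single) (use ord in \<open>simp add: dec_def\<close>)
  show "ck3 [x, Suc x, x] [Suc x, x, Suc x]" using ord by (simp add: ck3_iff; linarith)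
qed (use ord in \<open>auto simp: del_def word_perm_pair_commute simp del: word_perm.simps\<close>)

lemma ck_matched_xzy_2:
  assumes ord: "0 < x" "Suc x < y" "y < z"
  shows "ck_matched [x, z, y] (Suc (Suc 0)) [z, x, y] (Suc (Suc 0))"
proof (rule ck_matchedI)
  show "partial_bump [x, z, y] (Suc (Suc 0)) [x, z, y - 1] (Suc (Suc 0))" by (rule partial_bump_single) (use ord in \<open>simp add: dec_def\<close>)
  show "partial_bump [z, x, y] (Suc (Suc 0)) [z, x, y - 1] (Suc (Suc 0))" by (rule partial_bump_single) (use ord in \<open>simp add: dec_def\<close>)
  show "ck3 [x, z, y - 1] [z, x, y - 1]" using ord by (simp add: ck3_iff; linarith)
qed (use ord in \<open>auto simp: del_def word_perm_pair_commute simp del: word_perm.simps\<close>)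

lemma ck_matched_xzy_2':
  assumes ord: "0 < x" "Suc x < z"
  shows "ck_matched [x, z, Suc x] (Suc (Suc 0)) [z, x, Suc x] (Suc (Suc 0))"
proof (rule ck_matchedI)
  show "partial_bump [x, z, Suc x] (Suc (Suc 0)) [x - 1, z, x] 0"
    by (rule partial_bump_double[of _ _ "[x, z, x]"]) (use ord in \<open>simp_all add: dec_def swapped_triple_same del: swapped_Cons_0 swapped_Cons_Suc\<close>)
  show "partial_bump [z, x, Suc x] (Suc (Suc 0)) [z, x - 1, x] (Suc 0)"
    by (rule partial_bump_double[of _ _ "[z, x, x]"]) (use ord in \<open>simp_all add: dec_def swapped_triple_same del: swapped_Cons_0 swapped_Cons_Suc\<close>)
  show "ck3 [x - 1, z, x] [z, x - 1, x]" using ord by (simp add: ck3_iff; linarith)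
qed (use ord in \<open>auto simp: del_def word_perm_pair_commute simp del: word_perm.simps\<close>)

lemma ck_matched_braid_0:
  assumes ord: "0 < k"
  shows "ck_matched [k, Suc k, k] 0 [Suc k, k, Suc k] (Suc (Suc 0))"
proof (rule ck_matchedI)
  show "partial_bump [k, Suc k, k] 0 [k - 1, Suc k, k] 0" by (rule partial_bump_single) (use ord in \<open>simp add: dec_def\<close>)
  show "partial_bump [Suc k, k, Suc k] (Suc (Suc 0)) [Suc k, k - 1, k] (Suc 0)"
    by (rule partial_bump_double[of _ _ "[Suc k, k, k]"]) (use ord in \<open>simp_all add: dec_def swapped_triple_same del: swapped_Cons_0 swapped_Cons_Suc\<close>)
  show "ck3 [k - 1, Suc k, k] [Suc k, k - 1, k]" using ord by (simp add: ck3_iff; linarith)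
qed (use ord in \<open>auto simp: del_def word_perm_pair_commute simp del: word_perm.simps\<close>)

lemma ck_matched_braid_2:
  assumes ord: "0 < k"
  shows "ck_matched [k, Suc k, k] (Suc (Suc 0)) [Suc k, k, Suc k] 0"
proof (rule ck_matchedI)
  show "partial_bump [k, Suc k, k] (Suc (Suc 0)) [k, Suc k, k - 1] (Suc (Suc 0))" by (rule partial_bump_single) (use ord in \<open>simp add: dec_def\<close>)
  show "partial_bump [Suc k, k, Suc k] 0 [k, k - 1, Suc k] (Suc 0)"
    by (rule partial_bump_double[of _ _ "[k, k, Suc k]"]) (use ord in \<open>simp_all add: dec_def swapped_triple_same del: swapped_Cons_0 swapped_Cons_Suc\<close>)
  show "ck3 [k, Suc k, k - 1] [k, k - 1, Suc k]" using ord by (simp add: ck3_iff; linarith)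
qed (use ord in \<open>auto simp: del_def word_perm_pair_commute simp del: word_perm.simps\<close>)


lemma ck_matched_yxz:
  assumes "0 < x" "x < y" "y < z"
  shows "ck_matched [y, x, z] 0 [y, z, x] 0"
    "ck_matched [y, x, z] (Suc 0) [y, z, x] (Suc (Suc 0))"
    "ck_matched [y, x, z] (Suc (Suc 0)) [y, z, x] (Suc 0)"
proof -
  show "ck_matched [y, x, z] 0 [y, z, x] 0"
    using assms ck_matched_yxz_0[of x y z] ck_matched_yxz_0'[of x z] by (cases "Suc x = y") auto
  show "ck_matched [y, x, z] (Suc 0) [y, z, x] (Suc (Suc 0))" using assms by (rule ck_matched_yxz_1)
  consider "Suc y < z" | "z = Suc y" "Suc x < y" | "z = Suc y" "y = Suc x" using assms by linarith
  then show "ck_matched [y, x, z] (Suc (Suc 0)) [y, z, x] (Suc 0)"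
    using assms ck_matched_yxz_2[of x y z] ck_matched_yxz_2'[of x y] ck_matched_yxz_2''[of x] by cases simp_all
qed

lemma ck_matched_xzy:
  assumes "0 < x" "x < y" "y < z"
  shows "ck_matched [x, z, y] 0 [z, x, y] (Suc 0)"
    "ck_matched [x, z, y] (Suc 0) [z, x, y] 0"
    "ck_matched [x, z, y] (Suc (Suc 0)) [z, x, y] (Suc (Suc 0))"
proof -
  show "ck_matched [x, z, y] 0 [z, x, y] (Suc 0)" using assms by (rule ck_matched_xzy_0)
  show "ck_matched [x, z, y] (Suc (Suc 0)) [z, x, y] (Suc (Suc 0))"
    using assms ck_matched_xzy_2[of x y z] ck_matched_xzy_2'[of x z] by (cases "Suc x = y") auto
  consider "Suc y < z" | "z = Suc y" "Suc x < y" | "z = Suc y" "y = Suc x" using assms by linarith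
  then show "ck_matched [x, z, y] (Suc 0) [z, x, y] 0"
    using assms ck_matched_xzy_1[of x y z] ck_matched_xzy_1'[of x y] ck_matched_xzy_1''[of x] by cases simp_all
qed

lemma ck3_matched:
  assumes "ck3 W W'" "i < 3" "red (del i W)" "0 \<notin> set W"
  shows "\<exists>i'<3. ck_matched W i W' i'"
proof -
  have i: "i = 0 \<or> i = Suc 0 \<or> i = Suc (Suc 0)" using assms(2) by linarith
  have nr: "\<not> red [a, a]" for a
    using redD[of "[a, a]" 0 "Suc 0"] by (auto simp: insert_commute)
  from assms(1) show ?thesis
  proof cases
    case (1 x y z)
    then show ?thesis using i assms(4) ck_matched_yxz[of x y z] by (fastforce simp: numeral_3_eq_3)
  next
    case (2 x y z)
    then show ?thesis using i assms(4) ck_matched_yxz[of x y z, THEN ck_matched_sym]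
      by (fastforce simp: numeral_3_eq_3)
  next
    case (3 x y z)
    then show ?thesis using i assms(4) ck_matched_xzy[of x y z] by (fastforce simp: numeral_3_eq_3)
  next
    case (4 x y z)
    then show ?thesis using i assms(4) ck_matched_xzy[of x y z, THEN ck_matched_sym]
      by (fastforce simp: numeral_3_eq_3)
  next
    case (5 k)
    \<comment> \<open>Without its middle letter the braid triple would consist of two equal
      letters.\<close>
    then have "i \<noteq> Suc 0" using assms(3) nr by (auto simp: del_def)
    then show ?thesis using i 5 assms(4) ck_matched_braid_0[of k] ck_matched_braid_2[of k]
      by (fastforce simp: numeral_3_eq_3)
  next
    case (6 k)
    then have "i \<noteq> Suc 0" using assms(3) nr by (auto simp: del_def)
    then show ?thesis using i 6 assms(4) ck_matched_braid_0[of k, THEN ck_matched_sym] ck_matched_braid_2[of k, THEN ck_matched_sym]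
      by (fastforce simp: numeral_3_eq_3)
  qed
qed

section \<open>Parallel bumps of related words\<close>

text \<open>Inside the window the letters are permuted, so corresponding marks may have different
  indices there.\<close>

definition same_place :: "nat \<Rightarrow> nat \<Rightarrow> nat \<Rightarrow> bool" where
  "same_place j p p' \<longleftrightarrow> (if j \<le> p \<and> p < j + 3 then j \<le> p' \<and> p' < j + 3 else p' = p)"

lemma ck_at_factor: "ck3 W W' \<Longrightarrow> ck_at (length \<alpha>) (\<alpha> @ W @ \<beta>) (\<alpha> @ W' @ \<beta>)"
  unfolding ck_at_def by blast

text \<open>A mark outside the window leaves the two triples as they are, and one decrement on each
  side is enough. Inside the window \<open>ck3_matched\<close> supplies the partner and the one or
  two decrements.\<close>

lemma partial_bump_ck:
  assumes m: "marked u p" and ck: "ck_at j u u'"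
  shows "\<exists>p' x m x' m'. marked u' p' \<and> word_perm (del p' u') = word_perm (del p u) \<and> same_place j p p' \<and>
    partial_bump u p x m \<and> partial_bump u' p' x' m' \<and> same_place j m m' \<and> ck_at j x x'"
proof -
  obtain \<alpha> W W' \<beta> where u: "u = \<alpha> @ W @ \<beta>" "u' = \<alpha> @ W' @ \<beta>" "length \<alpha> = j" "ck3 W W'"
    using ck unfolding ck_at_def by blast
  have p: "p < length u" and z: "0 \<notin> set u" and r: "red (del p u)" using m by (auto simp: marked_def)
  have len: "length W = 3" "length W' = 3" using ck3_length[OF u(4)] by auto
  have marked': "marked u' p'" if "p' < length u'" "word_perm (del p' u') = word_perm (del p u)" for p'
    using red_same_perm[OF that(2)] that(1) r p z ck_at_set[OF ck] ck_at_length[OF ck]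
    by (simp add: marked_def)
  note W' = ck3_word_perm[OF u(4)]
  consider "p < j" | i where "p = j + i" "i < 3" | i where "p = j + (3 + i)"
    by (metis add.assoc le_add_diff_inverse less_diff_conv2 linorder_not_less add.commute)
  then show ?thesis
  proof cases
    case 1
    have dd: "del p u = del p \<alpha> @ W @ \<beta>" "del p u' = del p \<alpha> @ W' @ \<beta>"
      using 1 by (simp_all add: u del_def flip: u(3))
    then have "word_perm (del p u') = word_perm (del p u)" by (simp add: word_perm_append W')
    moreover have "ck_at j (dec u p) (dec u' p)"
      using 1 ck_at_factor[OF u(4), of "dec \<alpha> p" \<beta>] u(3) by (simp add: u(1,2) dec_factor_before)
    moreover have "marked u' p" using calculation(1) p ck_at_length[OF ck] by (intro marked') auto
    moreover have "partial_bump u p (dec u p) p" "partial_bump u' p (dec u' p) p" "same_place j p p"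
      using 1 by (auto simp: partial_bump_def same_place_def)
    ultimately show ?thesis by blast
  next
    case (2 i)
    have "del p u = \<alpha> @ del i W @ \<beta>" using 2 len by (simp add: u(1) del_factor flip: u(3))
    then have "red (del i W)" using r red_append1 red_append2 by metis
    then obtain i' where i': "i' < 3" "ck_matched W i W' i'"
      using ck3_matched[OF u(4) 2(2)] z by (auto simp: u(1))
    then obtain V k V' k' where V: "word_perm (del i' W') = word_perm (del i W)"
      "partial_bump W i V k" "partial_bump W' i' V' k'" "k < 3" "k' < 3" "ck3 V V'"
      unfolding ck_matched_def by blast
    have "word_perm (del (j + i') u') = word_perm (del p u)"
      using V(1) 2 i' len by (simp add: u(1,2) del_factor word_perm_append flip: u(3))
    moreover have "marked u' (j + i')" using calculation i' len by (intro marked') (simp_all add: u)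
    moreover have "partial_bump u p (\<alpha> @ V @ \<beta>) (j + k)"
      using partial_bump_factor[OF V(2), of \<alpha> \<beta>] 2 len by (simp add: u)
    moreover have "partial_bump u' (j + i') (\<alpha> @ V' @ \<beta>) (j + k')"
      using partial_bump_factor[OF V(3), of \<alpha> \<beta>] i' len by (simp add: u)
    moreover have "ck_at j (\<alpha> @ V @ \<beta>) (\<alpha> @ V' @ \<beta>)" using ck_at_factor[OF V(6)] u(3) by blast
    moreover have "same_place j p (j + i')" "same_place j (j + k) (j + k')"
      using 2 i' V by (auto simp: same_place_def)
    ultimately show ?thesis by blast
  next
    case (3 i)
    then have p3: "p = length \<alpha> + (length W + i)" "p = length \<alpha> + (length W' + i)" using u(3) len by simp_all
    have dd: "del p u = \<alpha> @ W @ del i \<beta>" "del p u' = \<alpha> @ W' @ del i \<beta>"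
      using 3 len by (simp_all add: u del_def flip: u(3))
    then have "word_perm (del p u') = word_perm (del p u)" by (simp add: word_perm_append W')
    moreover have "dec u p = \<alpha> @ W @ dec \<beta> i" unfolding u(1) p3(1) by (rule dec_factor_after)
    moreover have "dec u' p = \<alpha> @ W' @ dec \<beta> i" unfolding u(2) p3(2) by (rule dec_factor_after)
    moreover have "ck_at j (\<alpha> @ W @ dec \<beta> i) (\<alpha> @ W' @ dec \<beta> i)"
      using ck_at_factor[OF u(4)] u(3) by blast
    moreover have "marked u' p" using calculation(1) p ck_at_length[OF ck] by (intro marked') auto
    moreover have "partial_bump u p (dec u p) p" "partial_bump u' p (dec u' p) p" "same_place j p p"
      using 3 by (auto simp: partial_bump_def same_place_def)
    ultimately show ?thesis by metis
  qed
qed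

text \<open>The quotient of the two permutations is the transposition of the values at the deleted
  letter.\<close>

lemma swapped_eq_of_del:
  assumes "p < length u" "p' < length u'" "word_perm u = word_perm u'" "word_perm (del p u) = word_perm (del p' u')"
  shows "swapped u p = swapped u' p'"
proof -
  obtain x y where xy: "x < y" "swapped u p = {x, y}" by (rule swapped_pair_obtain)
  obtain x' y' where xy': "x' < y'" "swapped u' p' = {x', y'}" by (rule swapped_pair_obtain)
  have "transpose x y (word_perm (del p u) i) = transpose x' y' (word_perm (del p u) i)" for i
    using word_perm_del[OF assms(1) xy(2)] word_perm_del[OF assms(2) xy'(2)] assms(3,4)
    by (metis comp_apply)
  then have "transpose x y i = transpose x' y' i" for i
    by (metis word_perm_cancel_rev)
  from this[of x] this[of y] have "y = transpose x' y' x" "x = transpose x' y' y" by simp_all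
  then have "{x, y} = {x', y'}" using xy(1) by (auto simp: transpose_def split: if_splits)
  then show ?thesis using xy xy' by simp
qed

text \<open>Each side of a Coxeter--Knuth move is a reduced triple, and the prefix maps its pairs of
  values injectively.\<close>

lemma ck_at_window_no_conflict:
  assumes "ck_at j u u'" "j \<le> p" "p < j + 3" "j \<le> q" "q < j + 3" "swapped u p = swapped u q"
  shows "p = q"
proof -
  obtain \<alpha> W W' \<beta> where u: "u = \<alpha> @ W @ \<beta>" "length \<alpha> = j" "ck3 W W'"
    using assms(1) unfolding ck_at_def by blast
  have len: "length W = 3" using ck3_length[OF u(3)] by auto
  have "word_perm \<alpha> ` swapped W (p - j) = word_perm \<alpha> ` swapped W (q - j)"
    using assms swapped_factor[of "p - j" W \<alpha> \<beta>] swapped_factor[of "q - j" W \<alpha> \<beta>] u len by simp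
  then have "swapped W (p - j) = swapped W (q - j)" by (metis inj_image_eq_iff inj_word_perm)
  then have "p - j = q - j" using redD[OF ck3_red[OF u(3)], of "p - j" "q - j"] assms len by simp
  then show ?thesis using assms by simp
qed

text \<open>The equation for the deleted words pins down \<open>p'\<close>. In the induction it
  identifies the mark \<open>q'\<close> given by the hypothesis as the conflict of
  \<open>m'\<close>, where the bump of the related word continues.\<close>

lemma bump_ck:
  "marked u p \<Longrightarrow> ck_at j u u' \<Longrightarrow> \<exists>p'. marked u' p' \<and> word_perm (del p' u') = word_perm (del p u) \<and>
    same_place j p p' \<and> (\<forall>v. bump u p v \<longrightarrow> (\<exists>v'. bump u' p' v' \<and> ck_at j v v'))"
proof (induction "sum_list u" arbitrary: u u' p rule: less_induct)
  case less
  obtain p' x m x' m' where B: "marked u' p'" "word_perm (del p' u') = word_perm (del p u)" "same_place j p p'"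
    "partial_bump u p x m" "partial_bump u' p' x' m'" "same_place j m m'" "ck_at j x x'"
    using partial_bump_ck[OF less.prems] by blast
  note P = partial_bump[OF less.prems(1) B(4)]
  note P' = partial_bump[OF B(1) B(5)]
  have "\<exists>v'. bump u' p' v' \<and> ck_at j v v'" if v: "bump u p v" for v
  proof -
    have "settle x m v" using P(1) v by blast
    then show ?thesis
    proof (rule settle_cases[OF _ P(2) P(4) P(7)])
      assume "red x" "v = x"
      then have "settle x' m' x'" using ck_at_red[OF B(7)] by (simp add: settle_def)
      then show ?thesis using P'(1) B(7) \<open>v = x\<close> by blast
    next
      fix q assume q: "\<not> red x" "q < length x" "q \<noteq> m" "swapped x q = swapped x m" "bump x q v" "marked x q"
      obtain q' v' where q': "marked x' q'" "word_perm (del q' x') = word_perm (del q x)" "same_place j q q'"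
        "bump x' q' v'" "ck_at j v v'"
        using less.hyps[OF P(6) q(6) B(7)] q(5) by blast
      have lq': "q' < length x'" using q'(1) by (simp add: marked_def)
      have "word_perm (del q' x') = word_perm (del m' x')"
        using q'(2) conflict_del[OF P(2) q(2,4)] P(5) P'(5) B(2) by simp
      then have sw: "swapped x' q' = swapped x' m'" using swapped_eq_of_del[OF lq' P'(2)] by blast
      \<comment> \<open>Otherwise \<open>q\<close> and \<open>m\<close> either agree or lie in the
        same window, where reduced triples have no conflicts.\<close>
      have "q' \<noteq> m'"
      proof
        assume "q' = m'"
        then have "q = m \<or> j \<le> q \<and> q < j + 3 \<and> j \<le> m \<and> m < j + 3"
          using q'(3) B(6) by (auto simp: same_place_def split: if_splits)
        then show False using ck_at_window_no_conflict[OF B(7)] q(3,4) by blast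
      qed
      then have "settle x' m' v'"
        using sw lq' q'(4) q(1) ck_at_red[OF B(7)] by (auto simp: settle_def)
      then show ?thesis using P'(1) q'(5) by blast
    qed
  qed
  then show ?case using B by blast
qed

section \<open>Insertion by Coxeter--Knuth moves\<close>

text \<open>Reducedness of \<open>w\<close> makes adjacent letters different, so the comparisons
  made by insertion are strict.\<close>

definition bumped :: "nat list \<Rightarrow> nat list \<Rightarrow> bool" where
  "bumped w w' \<longleftrightarrow> red w \<and> (\<exists>p. marked w p \<and> bump w p w')"

lemma bumped_red: "bumped w w' \<Longrightarrow> red w \<and> red w'"
  unfolding bumped_def using bump_red by blast

lemma bumped_length: "bumped w w' \<Longrightarrow> length w' = length w"
  unfolding bumped_def using bump_length by blast

lemma red_adjacent: "red w \<Longrightarrow> Suc j < length w \<Longrightarrow> w ! j \<noteq> w ! Suc j"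
  using redD[of w "Suc j" j] swapped_adjacent[of j w] by auto

lemma bumped_ascent: "bumped w w' \<Longrightarrow> Suc j < length w \<Longrightarrow> w' ! j < w' ! Suc j \<longleftrightarrow> w ! j < w ! Suc j"
  unfolding bumped_def using bump_ascent red_adjacent by blast

lemma bumped_ck:
  assumes "bumped w w'" "ck_at j w v"
  shows "\<exists>v'. ck_at j w' v' \<and> bumped v v'"
proof -
  obtain p where p: "red w" "marked w p" "bump w p w'" using assms(1) unfolding bumped_def by blast
  obtain p' v' where "marked v p'" "bump v p' v'" "ck_at j w' v'"
    using bump_ck[OF p(2) assms(2)] p(3) by blast
  then show ?thesis using ck_at_red[OF assms(2)] p(1) unfolding bumped_def by blast
qed

text \<open>The trace of inserting into one row: the window slides to the right by one position per
  move, and only the starting word decides what happens.\<close>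

fun ck_path :: "nat \<Rightarrow> nat \<Rightarrow> nat list \<Rightarrow> nat list \<Rightarrow> bool" where
  "ck_path j 0 u v \<longleftrightarrow> v = u"
| "ck_path j (Suc n) u v \<longleftrightarrow> (\<exists>x. ck_at j u x \<and> ck_path (Suc j) n x v)"

lemma ck_path_det: "ck_path j n u v \<Longrightarrow> ck_path j n u v' \<Longrightarrow> v = v'"
  by (induction n arbitrary: j u) (auto dest: ck_at_det)

lemma bumped_ck_path: "bumped w w' \<Longrightarrow> ck_path j n w v \<Longrightarrow> \<exists>v'. ck_path j n w' v' \<and> bumped v v'"
proof (induction n arbitrary: j w w')
  case (Suc n)
  then obtain x where x: "ck_at j w x" "ck_path (Suc j) n x v" by auto
  obtain x' where x': "ck_at j w' x'" "bumped x x'" using bumped_ck[OF Suc.prems(1) x(1)] by blast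
  then show ?case using Suc.IH[OF x'(2) x(2)] by auto
qed auto

lemma ck_at_context: "ck_at j u v \<Longrightarrow> ck_at (length \<alpha> + j) (\<alpha> @ u @ \<beta>) (\<alpha> @ v @ \<beta>)"
proof -
  assume "ck_at j u v"
  then obtain a W W' b where u: "u = a @ W @ b" "v = a @ W' @ b" "length a = j" "ck3 W W'"
    unfolding ck_at_def by blast
  then show ?thesis using ck_at_factor[OF u(4), of "\<alpha> @ a" "b @ \<beta>"] by simp
qed

lemma ck_path_context: "ck_path j n u v \<Longrightarrow> ck_path (length \<alpha> + j) n (\<alpha> @ u @ \<beta>) (\<alpha> @ v @ \<beta>)"
proof (induction n arbitrary: j u)
  case (Suc n)
  then show ?case using ck_at_context[of j u _ \<alpha> \<beta>] by (metis add_Suc_right ck_path.simps(2))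
qed auto

lemma ck_path_Cons: "ck_path j n u v \<Longrightarrow> ck_path (Suc j) n (a # u) (a # v)"
  using ck_path_context[of j n u v "[a]" "[]"] by simp

declare eg_insert.simps(2) [simp del]

section \<open>Row insertion as a path of moves\<close>

text \<open>The letter \<open>y\<close> travels to the right: in \<open>c y d\<close> with
  \<open>d < c < y\<close> the witness \<open>c\<close> permits the exchange of \<open>y\<close> and
  \<open>d\<close>, and then \<open>d\<close> is the next witness.\<close>

lemma ck_path_carry:
  "c < y \<Longrightarrow> sorted_wrt (>) (c # ds) \<Longrightarrow> ck_path 0 (length ds) (c # y # ds) (c # ds @ [y])"
proof (induction ds arbitrary: c)
  case (Cons d ds)
  have "ck_at 0 (c # y # d # ds) (c # d # y # ds)"
    using ck_at_factor[of "[c, y, d]" "[c, d, y]" "[]" ds] Cons.prems by (simp add: ck3.intros)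
  moreover have "ck_path 0 (length ds) (d # y # ds) (d # ds @ [y])"
    using Cons by simp
  ultimately show ?case using ck_path_Cons[of 0 "length ds" "d # y # ds" _ c] by auto
qed simp

text \<open>First \<open>x\<close> travels through \<open>A\<close>, each exchange witnessed by the
  next larger-than-\<open>x\<close> entry of the row. At \<open>d\<close> the roles change and
  \<open>ck_path_carry\<close> takes \<open>d\<close> to the end; if \<open>x\<close> itself follows
  \<open>d\<close>, the turning move is a braid relation, which is the exceptional rule of the
  insertion.\<close>

lemma ck_path_row:
  assumes "sorted_wrt (>) (A @ d # B)" "x < d" "\<forall>b\<in>set B. b \<le> x" "red (x # A @ d # B)"
  shows "(B \<noteq> [] \<and> hd B = x \<longrightarrow> d = Suc x) \<and>
    ck_path 0 (length A + length B) (x # A @ d # B)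
      (if B \<noteq> [] \<and> hd B = x then A @ d # B @ [Suc x] else A @ x # B @ [d])"
  using assms
proof (induction A)
  case Nil
  show ?case
  proof (cases B)
    case (Cons b B')
    show ?thesis
    proof (cases "b = x")
      case True
      have "red [x, d, x]" using Nil.prems(4) red_append1[of "[x, d, x]" B'] by (simp add: Cons True)
      \<comment> \<open>Otherwise \<open>x\<close> and \<open>d\<close> commute, and the two letters
        \<open>x\<close> swap the same pair.\<close>
      then have "\<not> Suc x < d"
        using swapped_triple_same(3)[of x d] redD[of "[x, d, x]" "Suc (Suc 0)" 0] by fastforce
      then have d: "d = Suc x" using Nil.prems(2) by simp
      have "ck_at 0 (x # Suc x # x # B') (Suc x # x # Suc x # B')"
        using ck_at_factor[of "[x, Suc x, x]" "[Suc x, x, Suc x]" "[]" B'] by (simp add: ck3.intros)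
      moreover have "ck_path (Suc 0) (length B') (Suc x # x # Suc x # B') (Suc x # x # B' @ [Suc x])"
        using Nil.prems(1) Cons True by (intro ck_path_Cons ck_path_carry) auto
      ultimately show ?thesis using Cons True d by auto
    next
      case False
      have "ck_at 0 (x # d # b # B') (x # b # d # B')"
        using ck_at_factor[of "[x, d, b]" "[x, b, d]" "[]" B'] Nil.prems Cons False by (simp add: ck3.intros)
      moreover have "ck_path (Suc 0) (length B') (x # b # d # B') (x # b # B' @ [d])"
        using Nil.prems Cons by (intro ck_path_Cons ck_path_carry) auto
      ultimately show ?thesis using Cons False by auto
    qed
  qed simp
next
  case (Cons a A)
  obtain e es where e: "A @ d # B = e # es" by (cases A) auto
  have "x < e" "e < a"
    using e Cons.prems(1,2) by (cases A; auto)+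
  then have ck: "ck_at 0 (x # (a # A) @ d # B) (a # x # A @ d # B)"
    using ck_at_factor[of "[x, a, e]" "[a, x, e]" "[]" es] by (simp add: e ck3.intros)
  have "red (a # x # A @ d # B)" using ck_at_red[OF ck] Cons.prems(4) by simp
  then have "red (x # A @ d # B)" using red_append2[of "[a]"] by simp
  then have IH: "(B \<noteq> [] \<and> hd B = x \<longrightarrow> d = Suc x) \<and>
    ck_path 0 (length A + length B) (x # A @ d # B)
      (if B \<noteq> [] \<and> hd B = x then A @ d # B @ [Suc x] else A @ x # B @ [d])"
    using Cons by simp
  then have "ck_path (Suc 0) (length A + length B) (a # x # A @ d # B)
      (a # (if B \<noteq> [] \<and> hd B = x then A @ d # B @ [Suc x] else A @ x # B @ [d]))"
    by (intro ck_path_Cons) blast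
  then show ?case using ck IH by (auto simp del: append_Cons) (simp_all, blast+)
qed

lemma eg_insert_row:
  assumes s: "sorted_wrt (<) R" and ne: "R \<noteq> []" and lt: "x < last R" and r: "red (x # rev R)"
  obtains R' x' where "\<And>T. eg_insert x (R # T) = R' # eg_insert x' T" "length R' = length R"
    "sorted_wrt (<) R'" "ck_path 0 (length R - 1) (x # rev R) (rev R' @ [x'])"
proof -
  define j where "j = (LEAST j. j < length R \<and> x < R ! j)"
  have "\<exists>j. j < length R \<and> x < R ! j"
    using ne lt by (intro exI[of _ "length R - 1"]) (simp add: last_conv_nth)
  then have j: "j < length R" "x < R ! j" unfolding j_def by (metis (mono_tags, lifting) LeastI)+
  have before: "R ! i \<le> x" if "i < j" for i
    using not_less_Least[of i "\<lambda>j. j < length R \<and> x < R ! j"] that j(1) by (simp add: j_def[symmetric])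
  define C d D where "C = take j R" and "d = R ! j" and "D = drop (Suc j) R"
  have R: "R = C @ d # D" and lC: "length C = j"
    using j(1) by (simp_all add: C_def d_def D_def id_take_nth_drop[symmetric])
  have Cx: "\<forall>c\<in>set C. c \<le> x"
    using before j(1) by (auto simp: C_def in_set_conv_nth)
  have hd: "rev C \<noteq> [] \<and> hd (rev C) = x \<longleftrightarrow> 0 < j \<and> R ! (j - 1) = x"
    using lC by (cases "C = []") (auto simp: hd_rev last_conv_nth R nth_append)
  have sd: "sorted_wrt (>) (rev D @ d # rev C)" using s by (simp add: R sorted_wrt_append sorted_wrt_rev)
  have xd: "x < d" using j(2) by (simp add: d_def)
  have Cx': "\<forall>b\<in>set (rev C). b \<le> x" using Cx by simp
  have rR: "rev R = rev D @ d # rev C" by (simp add: R)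
  have len: "length (rev D) + length (rev C) = length R - 1" by (simp add: R)
  have rr: "red (x # rev D @ d # rev C)" using r by (simp only: rR)
  have *: "(0 < j \<and> R ! (j - 1) = x \<longrightarrow> d = Suc x) \<and>
    ck_path 0 (length R - 1) (x # rev R)
      (if 0 < j \<and> R ! (j - 1) = x then rev D @ d # rev C @ [Suc x] else rev D @ x # rev C @ [d])"
    using ck_path_row[OF sd xd Cx' rr] unfolding hd rR len .
  \<comment> \<open>By \<open>*\<close>, an entry \<open>x\<close> in front of \<open>R ! j\<close>
    forces \<open>R ! j = x + 1\<close>, so one condition decides both the insertion and the
    path.\<close>
  have eg: "eg_insert x (R # T) = (if 0 < j \<and> R ! (j - 1) = x then R # eg_insert (Suc x) T
    else R[j := x] # eg_insert d T)" for T
    unfolding eg_insert.simps(2) Let_def j_def[symmetric] using ne lt * by (auto simp: d_def)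
  show thesis
  proof (cases "0 < j \<and> R ! (j - 1) = x")
    case True
    have "ck_path 0 (length R - 1) (x # rev R) (rev D @ d # rev C @ [Suc x])" 
      using * unfolding if_P[OF True] by blast
    then have "ck_path 0 (length R - 1) (x # rev R) (rev R @ [Suc x])"
      by (simp only: rR append_assoc append_Cons)
    then show thesis by (intro that[of R "Suc x"]) (use eg True s in auto)
  next
    case False
    have R': "R[j := x] = C @ x # D" unfolding R lC[symmetric] by simp
    have sR: "sorted_wrt (<) C" "sorted_wrt (<) D" "\<forall>e\<in>set D. d < e" "\<forall>c\<in>set C. \<forall>e\<in>set D. c < e"
      using s by (auto simp: R sorted_wrt_append)
    have "c < x" if cC: "c \<in> set C" for c
    proof -
      \<comment> \<open>An entry \<open>x\<close> of \<open>C\<close> would be its last one, which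
        this case excludes.\<close>
      have "c \<noteq> x"
      proof
        assume "c = x"
        then obtain C1 C2 where C: "C = C1 @ x # C2" using split_list[of x C] cC by blast
        have "C2 = []" using sR(1) Cx by (cases C2) (auto simp: C sorted_wrt_append)
        then have "rev C \<noteq> [] \<and> hd (rev C) = x" by (simp add: C)
        then show False using False hd by blast
      qed
      then show ?thesis using Cx cC by (simp add: order.strict_iff_order)
    qed
    moreover have "x < e" if "e \<in> set D" for e using sR(3) xd that by fastforce
    ultimately have "sorted_wrt (<) (R[j := x])" using sR unfolding R' by (auto simp: sorted_wrt_append)
    moreover have "ck_path 0 (length R - 1) (x # rev R) (rev (R[j := x]) @ [d])" 
      using * unfolding if_not_P[OF False] by (simp add: R')
    ultimately show thesis by (intro that[of "R[j := x]" d]) (use eg False in auto)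
  qed
qed

section \<open>Parallel insertion of a word and its bump\<close>

definition reading :: "nat list list \<Rightarrow> nat list" where
  "reading T = concat (map rev T)"

definition increasing_rows :: "nat list list \<Rightarrow> bool" where
  "increasing_rows T \<longleftrightarrow> (\<forall>R\<in>set T. R \<noteq> [] \<and> sorted_wrt (<) R)"

lemma reading_simps [simp]: "reading [] = []" "reading (R # T) = rev R @ reading T"
  by (simp_all add: reading_def)

lemma increasing_rows_simps [simp]:
  "increasing_rows []"
  "increasing_rows (R # T) \<longleftrightarrow> R \<noteq> [] \<and> sorted_wrt (<) R \<and> increasing_rows T"
  by (auto simp: increasing_rows_def)

lemma eg_insert_append: "last R \<le> x \<Longrightarrow> eg_insert x (R # T) = (R @ [x]) # T"
  by (simp add: eg_insert.simps(2))

text \<open>The prefix \<open>\<alpha>\<close> holds the letters not yet inserted and the rows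
  already passed, so the bump always concerns the complete word.\<close>

lemma bumped_eg_insert:
  assumes "bumped (\<alpha> @ x # reading T) (\<alpha>' @ x' # reading T')" "length \<alpha>' = length \<alpha>"
    "increasing_rows T" "increasing_rows T'" "map length T' = map length T"
  shows "bumped (\<alpha> @ reading (eg_insert x T)) (\<alpha>' @ reading (eg_insert x' T')) \<and>
    increasing_rows (eg_insert x T) \<and> increasing_rows (eg_insert x' T') \<and>
    map length (eg_insert x' T') = map length (eg_insert x T)"
  using assms
proof (induction T arbitrary: \<alpha> \<alpha>' x x' T')
  case (Cons R T)
  then obtain R' U where T': "T' = R' # U" by auto
  have len: "length R' = length R" "map length U = map length T" using Cons.prems(5) T' by auto
  have R: "R \<noteq> []" "sorted_wrt (<) R" "increasing_rows T"
    and R': "R' \<noteq> []" "sorted_wrt (<) R'" "increasing_rows U" using Cons.prems(3,4) T' by auto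
  let ?w = "\<alpha> @ x # rev R @ reading T" and ?w' = "\<alpha>' @ x' # rev R' @ reading U"
  have b: "bumped ?w ?w'" using Cons.prems(1) T' by simp
  have r: "red ?w" "red ?w'" using bumped_red[OF b] by auto
  have nth: "?w ! length \<alpha> = x" "?w ! Suc (length \<alpha>) = last R"
    "?w' ! length \<alpha> = x'" "?w' ! Suc (length \<alpha>) = last R'" "Suc (length \<alpha>) < length ?w"
    "Suc (length \<alpha>) < length ?w'"
    using Cons.prems(2) R(1) R'(1) by (auto simp: nth_append rev_nth last_conv_nth)
  \<comment> \<open>In the word, \<open>x\<close> stands directly before \<open>last R\<close>. The
    preserved comparison of these neighbours decides between appending and bumping.\<close>
  have iff: "x' < last R' \<longleftrightarrow> x < last R" using bumped_ascent[OF b nth(5)] nth(1-4) by simp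
  have ne: "x \<noteq> last R" "x' \<noteq> last R'"
    using red_adjacent[OF r(1) nth(5)] red_adjacent[OF r(2) nth(6)] nth(1-4) by auto
  show ?case
  proof (cases "x < last R")
    case False
    then have lt: "last R < x" "last R' < x'" using iff ne by auto
    have "y < x" if "y \<in> set R" for y
      using that lt(1) R(1,2) sorted_wrt_append[of "(<)" "butlast R" "[last R]"] by (cases R rule: rev_cases) auto
    moreover have "y < x'" if "y \<in> set R'" for y
      using that lt(2) R'(1,2) sorted_wrt_append[of "(<)" "butlast R'" "[last R']"] by (cases R' rule: rev_cases) auto
    ultimately show ?thesis
      using b R R' len eg_insert_append[OF less_imp_le[OF lt(1)]] eg_insert_append[OF less_imp_le[OF lt(2)]]
      by (simp add: T' sorted_wrt_append)
  next
    case True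
    then have True': "x' < last R'" using iff by simp
    have rr: "red (x # rev R)" "red (x' # rev R')"
      using r red_append2[of \<alpha> "(x # rev R) @ reading T"] red_append1[of "x # rev R" "reading T"]
        red_append2[of \<alpha>' "(x' # rev R') @ reading U"] red_append1[of "x' # rev R'" "reading U"] by auto
    obtain R1 x1 where r1: "\<And>T. eg_insert x (R # T) = R1 # eg_insert x1 T" "length R1 = length R"
      "sorted_wrt (<) R1" "ck_path 0 (length R - 1) (x # rev R) (rev R1 @ [x1])"
      using eg_insert_row[OF R(2,1) True rr(1)] by blast
    obtain R1' x1' where r1': "\<And>T. eg_insert x' (R' # T) = R1' # eg_insert x1' T" "length R1' = length R'"
      "sorted_wrt (<) R1'" "ck_path 0 (length R' - 1) (x' # rev R') (rev R1' @ [x1'])"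
      using eg_insert_row[OF R'(2,1) True' rr(2)] by blast
    have p: "ck_path (length \<alpha>) (length R - 1) ?w (\<alpha> @ rev R1 @ x1 # reading T)"
      using ck_path_context[OF r1(4), of \<alpha> "reading T"] by simp
    have p': "ck_path (length \<alpha>) (length R - 1) ?w' (\<alpha>' @ rev R1' @ x1' # reading U)"
      using ck_path_context[OF r1'(4), of \<alpha>' "reading U"] Cons.prems(2) len by simp
    \<comment> \<open>The bump carries the first path over to the second word, and by determinism
      the result is that of the second insertion.\<close>
    obtain v where "ck_path (length \<alpha>) (length R - 1) ?w' v" "bumped (\<alpha> @ rev R1 @ x1 # reading T) v"
      using bumped_ck_path[OF b p] by blast
    then have "bumped ((\<alpha> @ rev R1) @ x1 # reading T) ((\<alpha>' @ rev R1') @ x1' # reading U)"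
      using ck_path_det[OF p'] by simp
    from Cons.IH[OF this _ R(3) R'(3) len(2)] show ?thesis
      using Cons.prems(2) r1(1-3) r1'(1-3) len R(1) R'(1) T' by auto
  qed
qed auto

lemma EG_P_Cons: "EG_P (x # w) = eg_insert x (EG_P w)"
  by (simp add: EG_P_def)

lemma EG_P_Nil [simp]: "EG_P [] = []"
  by (simp add: EG_P_def)

text \<open>An arbitrary uninserted prefix makes the claim available at every stage of the
  insertion, as \<open>EG_Q\<close> requires.\<close>

lemma bumped_EG_P:
  assumes "length v' = length v" "length \<alpha>' = length \<alpha>" "bumped (\<alpha> @ v) (\<alpha>' @ v')"
  shows "bumped (\<alpha> @ reading (EG_P v)) (\<alpha>' @ reading (EG_P v')) \<and>
    increasing_rows (EG_P v) \<and> increasing_rows (EG_P v') \<and> map length (EG_P v') = map length (EG_P v)"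
  using assms
proof (induction v arbitrary: \<alpha> \<alpha>' v')
  case (Cons x v)
  then obtain x' u where v': "v' = x' # u" by (cases v') auto
  have "bumped ((\<alpha> @ [x]) @ reading (EG_P v)) ((\<alpha>' @ [x']) @ reading (EG_P u)) \<and>
    increasing_rows (EG_P v) \<and> increasing_rows (EG_P u) \<and> map length (EG_P u) = map length (EG_P v)"
    using Cons v' by (intro Cons.IH) auto
  then show ?case using bumped_eg_insert[of \<alpha> x "EG_P v" \<alpha>' x' "EG_P u"] Cons.prems(2) 
    by (simp add: v' EG_P_Cons)
qed auto

lemma cells_eqI:
  assumes eq: "map length T = map length T'"
  shows "cells T = cells T'"
proof -
  have len: "length T = length T'" using arg_cong[OF eq, of length] by simp
  have "length (T ! i) = length (T' ! i)" if "i < length T" for i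
    using arg_cong[OF eq, of "\<lambda>l. l ! i"] that len by simp
  then show ?thesis using len by (auto simp: cells_def)
qed

lemma EG_Q_eqI:
  "length w' = length w \<Longrightarrow> (\<And>i. map length (EG_P (drop i w')) = map length (EG_P (drop i w))) \<Longrightarrow> EG_Q w' = EG_Q w"
proof (induction w' w rule: list_induct2)
  case (Cons x' w' x w)
  have "EG_Q w' = EG_Q w" using Cons.prems[of "Suc _"] by (intro Cons.IH) simp
  moreover have "cells (EG_P (x' # w')) = cells (EG_P (x # w))" "cells (EG_P w') = cells (EG_P w)"
    using Cons.prems[of 0] Cons.prems[of "Suc 0"] by (intro cells_eqI, simp)+
  ultimately show ?case using Cons.hyps by (simp add: fun_eq_iff)
qed auto

lemma bumped_EG_Q:
  assumes "bumped w w'"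
  shows "EG_Q w' = EG_Q w"
proof (rule EG_Q_eqI)
  show len: "length w' = length w" using assms by (rule bumped_length)
  show "map length (EG_P (drop i w')) = map length (EG_P (drop i w))" for i
    using bumped_EG_P[of "drop i w'" "drop i w" "take i w'" "take i w"] assms len by simp
qed

text \<open>Insertion only compares entries and tests for successors. This absorbs the shift that
  \<open>unzero\<close> makes.\<close>

lemma eg_insert_map_Suc: "eg_insert (Suc x) (map (map Suc) T) = map (map Suc) (eg_insert x T)"
proof (induction T arbitrary: x)
  case (Cons R T)
  define j where "j = (LEAST j. j < length R \<and> x < R ! j)"
  have jj: "(LEAST j. j < length (map Suc R) \<and> Suc x < map Suc R ! j) = j"
    unfolding j_def by (rule arg_cong[of _ _ Least]) auto
  show ?case
  proof (cases "R = [] \<or> last R \<le> x")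
    case True
    then show ?thesis by (auto simp: eg_insert.simps(2) last_map)
  next
    case False
    have "\<exists>j. j < length R \<and> x < R ! j"
      using False by (intro exI[of _ "length R - 1"]) (auto simp: last_conv_nth)
    then have "j < length R" unfolding j_def by (metis (mono_tags, lifting) LeastI)
    then show ?thesis using False Cons.IH
      by (simp add: eg_insert.simps(2) last_map Let_def jj[simplified] j_def[symmetric] map_update)
  qed
qed auto

lemma EG_P_map_Suc: "EG_P (map Suc w) = map (map Suc) (EG_P w)"
  by (induction w) (simp_all add: EG_P_Cons eg_insert_map_Suc)

lemma EG_Q_map_Suc: "EG_Q (map Suc w) = EG_Q w"
proof (rule EG_Q_eqI)
  fix i show "map length (EG_P (drop i (map Suc w))) = map length (EG_P (drop i w))"
    by (simp add: drop_map EG_P_map_Suc comp_def)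
qed simp

lemma EG_Q_little_bump: "red w \<Longrightarrow> marked w p \<Longrightarrow> bump w p v \<Longrightarrow> EG_Q (unzero v) = EG_Q w"
  using bumped_EG_Q[of w v] by (auto simp: unzero_def EG_Q_map_Suc bumped_def)

section \<open>Grassmannian words\<close>

text \<open>With \<open>k\<close> fixed and the absence of descents allowed, the property passes to
  the tails of a reduced word, down to the identity.\<close>

definition ascending_except :: "nat \<Rightarrow> (nat \<Rightarrow> nat) \<Rightarrow> bool" where
  "ascending_except k f \<longleftrightarrow> (\<forall>c\<ge>1. c \<noteq> k \<longrightarrow> f c < f (Suc c))"

lemma ascending_except_mono:
  assumes "ascending_except k f" "1 \<le> c" "c < d" "d \<le> k \<or> k < c"
  shows "f c < f d"
  using assms(3,4)
proof (induction d)
  case (Suc d)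
  have "f d < f (Suc d)" using assms(1,2) Suc.prems unfolding ascending_except_def by auto
  then show ?case using Suc by (cases "c = d") auto
qed simp

text \<open>
  The partition of a Grassmannian permutation with descent \<open>k\<close>: \<open>r i\<close> is the length of the row of
  the value at position \<open>k - i\<close>, and \<open>h j\<close> is the height of the column of the value at \<open>k + 1 + j\<close>.
\<close>

definition grass_shape :: "nat \<Rightarrow> nat list \<Rightarrow> (nat \<Rightarrow> nat) \<Rightarrow> (nat \<Rightarrow> nat) \<Rightarrow> bool" where
  "grass_shape k w r h \<longleftrightarrow>
    (\<forall>i<k. word_perm w (k - i) = k - i + r i) \<and>
    (\<forall>j. word_perm w (k + 1 + j) = k + 1 + j - h j) \<and>
    (\<forall>j. h j \<le> k) \<and> (\<forall>i j. j < r i \<longleftrightarrow> i < h j)"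

lemma grass_shape_Nil: "grass_shape k [] (\<lambda>_. 0) (\<lambda>_. 0)"
  by (simp add: grass_shape_def)

text \<open>The first letter inverts the positions \<open>a < b\<close> of the values
  \<open>x\<close> and \<open>Suc x\<close>, and an inversion must straddle the only possible
  descent.\<close>

lemma grass_positions:
  assumes red: "reduced (x # v)" and asc: "ascending_except k (word_perm (x # v))"
  obtains a b where "word_perm v a = x" "word_perm v b = Suc x" "1 \<le> a" "a \<le> k" "k < b"
proof -
  have x: "1 \<le> x" and zv: "0 \<notin> set v" and rd: "red (x # v)" using red by (auto simp: reduced_iff_red)
  define a b where "a = word_perm (rev v) x" and "b = word_perm (rev v) (Suc x)"
  have va: "word_perm v a = x" "word_perm v b = Suc x" by (simp_all add: a_def b_def)
  have ab: "a < b" using red_Cons_ascent[OF rd] by (simp add: a_def b_def)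
  have a1: "1 \<le> a"
  proof (rule ccontr)
    assume "\<not> 1 \<le> a"
    then have "a = 0" by simp
    then show False using va(1) word_perm_0[OF zv] x by simp
  qed
  have "word_perm (x # v) a = Suc x" "word_perm (x # v) b = x" by (simp_all add: va)
  then have "\<not> (b \<le> k \<or> k < a)" using ascending_except_mono[OF asc a1 ab] by auto
  then show thesis using that[of a b] va a1 by simp
qed

lemma ascending_except_tail:
  assumes red: "reduced (x # v)" and asc: "ascending_except k (word_perm (x # v))"
  shows "ascending_except k (word_perm v)"
  unfolding ascending_except_def
proof (intro allI impI)
  fix c assume c: "1 \<le> c" "c \<noteq> k"
  obtain a b where ab: "word_perm v a = x" "word_perm v b = Suc x" "1 \<le> a" "a \<le> k" "k < b"
    using grass_positions[OF assms] .
  have lt: "word_perm (x # v) c < word_perm (x # v) (Suc c)" using asc c by (auto simp: ascending_except_def)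
  show "word_perm v c < word_perm v (Suc c)"
  proof (rule ccontr)
    assume "\<not> ?thesis"
    then have "word_perm v (Suc c) < word_perm v c"
      by (metis linorder_neqE_nat n_not_Suc_n word_perm_eq_iff)
    then have "word_perm v c = Suc x \<and> word_perm v (Suc c) = x"
      using lt by (auto simp: transpose_def split: if_splits)
    then have "c = b" "Suc c = a" using ab(1,2) by (metis word_perm_eq_iff)+
    then show False using ab by simp
  qed
qed

lemma grass_shape_Cons:
  assumes g: "grass_shape k v r h" and red: "reduced (x # v)" and asc: "ascending_except k (word_perm (x # v))"
  obtains i j where "i < k" "r i = j" "h j = i" "x = k + j - i"
    "word_perm (x # v) (k - i) = Suc x" "word_perm (x # v) (k + 1 + j) = x"
    "grass_shape k (x # v) (r(i := Suc j)) (h(j := Suc i))"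
proof -
  obtain a b where va: "word_perm v a = x" "word_perm v b = Suc x" and a1: "1 \<le> a" and akb: "a \<le> k" "k < b"
    using grass_positions[OF red asc] .
  have wab: "word_perm (x # v) a = Suc x" "word_perm (x # v) b = x" by (simp_all add: va)
  define i j where "i = k - a" and "j = b - (k + 1)"
  have aeq: "a = k - i" and i: "i < k" and beq: "b = k + 1 + j"
    using akb a1 by (auto simp: i_def j_def)
  have G: "\<And>i. i < k \<Longrightarrow> word_perm v (k - i) = k - i + r i" "\<And>j. word_perm v (k + 1 + j) = k + 1 + j - h j"
    "\<And>j. h j \<le> k" "\<And>i j. j < r i \<longleftrightarrow> i < h j" using g by (auto simp: grass_shape_def)
  have e1: "x = k - i + r i" using G(1)[OF i] va(1) aeq by simp
  have e2: "Suc x = k + 1 + j - h j" using G(2)[of j] va(2) beq by simp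
  have hj: "h j \<le> k" by (rule G(3))
  have "\<not> j < r i"
  proof
    assume "j < r i"
    then show False using G(4)[of j i] e1 e2 hj i by linarith
  qed
  \<comment> \<open>Equating \<open>e1\<close> and \<open>e2\<close> gives
    \<open>r i + h j = i + j\<close>. As \<open>j < r i\<close> iff \<open>i < h j\<close>, neither
    summand can exceed its share: the new box is an addable corner.\<close>
  then have "r i = j \<and> h j = i" using G(4)[of j i] e1 e2 hj i by linarith
  then have ri: "r i = j" and hji: "h j = i" by auto
  have other: "word_perm (x # v) c = word_perm v c" if "c \<noteq> a" "c \<noteq> b" for c
    using that va by (metis comp_apply transpose_apply_other word_perm.simps(2) word_perm_eq_iff)
  have "grass_shape k (x # v) (r(i := Suc j)) (h(j := Suc i))"
    unfolding grass_shape_def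
  proof (intro conjI allI impI)
    fix i0 assume i0: "i0 < k"
    show "word_perm (x # v) (k - i0) = k - i0 + (r(i := Suc j)) i0"
    proof (cases "i0 = i")
      case True
      then show ?thesis using wab(1) aeq e1 ri by simp
    next
      case False
      then have "k - i0 \<noteq> a" "k - i0 \<noteq> b" using i0 i aeq beq by auto
      then have "word_perm (x # v) (k - i0) = word_perm v (k - i0)" by (rule other)
      then show ?thesis using G(1)[OF i0] False by (simp del: word_perm.simps)
    qed
  next
    fix j0
    show "word_perm (x # v) (k + 1 + j0) = k + 1 + j0 - (h(j := Suc i)) j0"
    proof (cases "j0 = j")
      case True
      then show ?thesis using wab(2) beq e2 hji by simp
    next
      case False
      then have "k + 1 + j0 \<noteq> a" "k + 1 + j0 \<noteq> b" using aeq beq by auto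
      then have "word_perm (x # v) (k + 1 + j0) = word_perm v (k + 1 + j0)" by (rule other)
      then show ?thesis using G(2)[of j0] False by (simp del: word_perm.simps)
    qed
  next
    fix j0 show "(h(j := Suc i)) j0 \<le> k" using G(3)[of j0] i by simp
  next
    fix i0 j0
    show "j0 < (r(i := Suc j)) i0 \<longleftrightarrow> i0 < (h(j := Suc i)) j0"
      using G(4)[of j0 i0] ri hji by auto
  qed
  moreover have "x = k + j - i" using e1 ri i by simp
  ultimately show thesis using that[of i j] i ri hji wab aeq beq by simp
qed

text \<open>The insertion tableau: every column \<open>j\<close> consists of consecutive numbers and ends with \<open>k + j\<close>.\<close>

definition grass_row :: "nat \<Rightarrow> (nat \<Rightarrow> nat) \<Rightarrow> (nat \<Rightarrow> nat) \<Rightarrow> nat \<Rightarrow> nat list" where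
  "grass_row k r h i = map (\<lambda>j. k + j + i + 1 - h j) [0..<r i]"

lemma eg_insert_replace:
  assumes "j < length R" "R ! j = Suc y" "\<And>j'. j' < j \<Longrightarrow> R ! j' < y" "y < last R"
  shows "eg_insert y (R # T) = R[j := y] # eg_insert (Suc y) T"
proof -
  have "(LEAST j. j < length R \<and> y < R ! j) = j"
  proof (rule Least_equality)
    fix j' assume "j' < length R \<and> y < R ! j'"
    then show "j \<le> j'" using assms(3)[of j'] by (metis linorder_not_less order.asym)
  qed (use assms in simp)
  moreover have "\<not> (0 < j \<and> R ! (j - 1) = y)" using assms(3)[of "j - 1"] by auto
  moreover have "R \<noteq> []" using assms(1) by auto
  ultimately show ?thesis using assms by (auto simp: eg_insert.simps(2))
qed

text \<open>The row reached so far is \<open>t\<close>. Above row \<open>i\<close> the entry of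
  column \<open>j\<close> is the successor of the arriving number, is replaced by it and moves one
  row down; in row \<open>i\<close> the arriving number is \<open>k + j\<close> and is appended. So
  column \<open>j\<close> sinks by one box.\<close>

lemma eg_insert_grass:
  assumes h: "\<And>j. h j \<le> k" and rh: "\<And>i j. j < r i \<longleftrightarrow> i < h j"
    and ri: "r i = j" and hj: "h j = i" and i: "i < k" and t: "t \<le> i"
  shows "eg_insert (k + j + t - i) (map (grass_row k r h) [t..<h 0]) =
    map (grass_row k (r(i := Suc j)) (h(j := Suc i))) [t..<(h(j := Suc i)) 0]"
  using t
proof (induction "i - t" arbitrary: t)
  case 0
  then have ti: "t = i" by simp
  have same: "grass_row k (r(i := Suc j)) (h(j := Suc i)) s = grass_row k r h s" if "i < s" for s
    using that rh[of j s] hj by (auto simp: grass_row_def)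
  have new: "grass_row k (r(i := Suc j)) (h(j := Suc i)) i = grass_row k r h i @ [k + j]"
    by (auto simp: grass_row_def ri)
  show ?case
  proof (cases "i < h 0")
    case True
    then have j: "0 < j" using rh[of 0 i] ri by simp
    have "last (grass_row k r h i) = k + (j - 1) + i + 1 - h (j - 1)"
      using j by (simp add: grass_row_def ri last_conv_nth)
    moreover have "i < h (j - 1)" using rh[of "j - 1" i] ri j by simp
    ultimately have "last (grass_row k r h i) \<le> k + j" using j by linarith
    then have "eg_insert (k + j) (grass_row k r h i # map (grass_row k r h) [Suc i..<h 0]) =
      (grass_row k r h i @ [k + j]) # map (grass_row k r h) [Suc i..<h 0]" by (rule eg_insert_append)
    moreover have "map (grass_row k (r(i := Suc j)) (h(j := Suc i))) [Suc i..<h 0] = map (grass_row k r h) [Suc i..<h 0]"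
      using same by (intro map_cong) auto
    moreover have "(h(j := Suc i)) 0 = h 0" using j by simp
    moreover have "[i..<h 0] = i # [Suc i..<h 0]" using True by (rule upt_conv_Cons)
    ultimately show ?thesis by (simp only: ti list.map new add_diff_cancel_right')
  next
    case False
    \<comment> \<open>Row \<open>i\<close> does not exist yet, so the box opens it in the first
      column.\<close>
    then have "j = 0" using rh[of 0 i] ri by simp
    then have "h 0 = i" using hj by simp
    then show ?thesis using ti \<open>j = 0\<close> new by (simp add: grass_row_def ri)
  qed
next
  case (Suc d)
  then have ti: "t < i" by simp
  have jrt: "j < r t" using rh[of j t] hj ti by simp
  have th: "t < h 0" using rh[of 0 t] jrt by simp
  let ?R = "grass_row k r h t" and ?y = "k + j + t - i"
  have len: "length ?R = r t" by (simp add: grass_row_def)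
  have nth: "?R ! j0 = k + j0 + t + 1 - h j0" if "j0 < r t" for j0
    using that by (simp add: grass_row_def)
  have "?R ! j = Suc ?y" using nth[OF jrt] hj i by simp
  \<comment> \<open>Columns to the left of \<open>j\<close> reach row \<open>i\<close>, hence are
    higher than column \<open>j\<close>, and so their entries in row \<open>t\<close> are small
    enough.\<close>
  moreover have "?R ! j0 < ?y" if "j0 < j" for j0
  proof -
    have "i < h j0" using rh[of j0 i] ri that by simp
    then show ?thesis using nth[of j0] that jrt i by simp
  qed
  moreover have "?y < last ?R"
  proof -
    have "\<not> i < h (r t - 1) \<or> r t - 1 = j" using rh[of "r t - 1" i] ri jrt by auto
    then have "h (r t - 1) \<le> i" using hj by auto
    moreover have "last ?R = k + (r t - 1) + t + 1 - h (r t - 1)"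
      using jrt by (subst last_conv_nth) (auto simp: grass_row_def)
    ultimately show ?thesis using jrt i by linarith
  qed
  ultimately have ins: "eg_insert ?y (?R # T) = ?R[j := ?y] # eg_insert (Suc ?y) T" for T
    using jrt len by (intro eg_insert_replace) auto
  have row: "?R[j := ?y] = grass_row k (r(i := Suc j)) (h(j := Suc i)) t"
  proof (rule nth_equalityI)
    fix s assume "s < length (?R[j := ?y])"
    then show "?R[j := ?y] ! s = grass_row k (r(i := Suc j)) (h(j := Suc i)) t ! s"
      using ti len hj i by (cases "s = j") (auto simp: grass_row_def)
  qed (use ti len in \<open>simp add: grass_row_def\<close>)
  have "Suc ?y = k + j + Suc t - i" using i by simp
  then have IH: "eg_insert (Suc ?y) (map (grass_row k r h) [Suc t..<h 0]) =
      map (grass_row k (r(i := Suc j)) (h(j := Suc i))) [Suc t..<(h(j := Suc i)) 0]"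
    using Suc.hyps(1)[of "Suc t"] Suc.hyps(2) ti by simp
  have "t < (h(j := Suc i)) 0" using th ti by simp
  then have "[t..<(h(j := Suc i)) 0] = t # [Suc t..<(h(j := Suc i)) 0]" by (rule upt_conv_Cons)
  moreover have "[t..<h 0] = t # [Suc t..<h 0]" using th by (rule upt_conv_Cons)
  ultimately show ?case by (simp only: list.map ins IH row)
qed

lemma cells_grass:
  assumes "\<And>i j. j < r i \<longleftrightarrow> i < h j"
  shows "cells (map (grass_row k r h) [0..<h 0]) = {(i, j). j < r i}"
proof -
  have "i < h 0" if "j < r i" for i j using that assms[of 0 i] by simp
  then show ?thesis by (auto simp: cells_def grass_row_def)
qed

section \<open>The grid of a Grassmannian word\<close>

text \<open>This is \<open>tab_grid\<close> with \<open>k\<close> as a parameter, which stays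
  meaningful for tails whose permutation has no descent.\<close>

definition grid :: "nat \<Rightarrow> nat list \<Rightarrow> filling" where
  "grid k w = (\<lambda>(i, j).
     let here = (\<lambda>p. p < length w \<and> swapped w p = {word_perm w (k - i), word_perm w (k + 1 + j)})
     in if i < k \<and> (\<exists>p. here p) then Some (length w - (THE p. here p)) else None)"

lemma grid_eqI:
  assumes "red w" "i < k" "p < length w" "swapped w p = {word_perm w (k - i), word_perm w (k + 1 + j)}"
  shows "grid k w (i, j) = Some (length w - p)"
proof -
  have "(THE p. p < length w \<and> swapped w p = {word_perm w (k - i), word_perm w (k + 1 + j)}) = p"
    using assms(3,4) redD[OF assms(1)] by (intro the_equality) auto
  then show ?thesis using assms(2-4) unfolding grid_def by (auto simp: Let_def)
qed

lemma grid_eq_None: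
  assumes "\<And>p. i < k \<Longrightarrow> p < length w \<Longrightarrow> swapped w p \<noteq> {word_perm w (k - i), word_perm w (k + 1 + j)}"
  shows "grid k w (i, j) = None"
  using assms unfolding grid_def by (auto simp: Let_def)

text \<open>The new front letter renames the values on both sides of the test alike. Index and
  length both grow by one, so the old entries stay.\<close>

lemma grid_Cons:
  assumes r: "red (x # v)" and i: "i < k"
    and w: "word_perm (x # v) (k - i) = Suc x" "word_perm (x # v) (k + 1 + j) = x"
  shows "grid k (x # v) = (grid k v)((i, j) \<mapsto> Suc (length v))"
proof
  fix c :: "nat \<times> nat"
  obtain i0 j0 where c: "c = (i0, j0)" by fastforce
  have rv: "red v" using red_append2[of "[x]" v] r by simp
  let ?W = "\<lambda>i j. {word_perm (x # v) (k - i), word_perm (x # v) (k + 1 + j)}"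
  let ?V = "\<lambda>i j. {word_perm v (k - i), word_perm v (k + 1 + j)}"
  have W: "?W i0 j0 = transpose x (Suc x) ` ?V i0 j0" by simp
  show "grid k (x # v) c = ((grid k v)((i, j) \<mapsto> Suc (length v))) c"
  proof (cases "c = (i, j)")
    case True
    have "swapped (x # v) 0 = ?W i j" unfolding w by auto
    then have "grid k (x # v) (i, j) = Some (length (x # v) - 0)" using r i by (intro grid_eqI) auto
    then show ?thesis using True by simp
  next
    case False
    have g: "grid k (x # v) (i0, j0) = grid k v (i0, j0)"
    proof (cases "\<exists>p<length v. i0 < k \<and> swapped v p = ?V i0 j0")
      case True
      then obtain p where p: "p < length v" "i0 < k" "swapped v p = ?V i0 j0" by blast
      have "grid k v (i0, j0) = Some (length v - p)" by (rule grid_eqI[OF rv p(2,1,3)])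
      moreover have "grid k (x # v) (i0, j0) = Some (length (x # v) - Suc p)"
      proof (rule grid_eqI[OF r p(2)])
        show "swapped (x # v) (Suc p) = ?W i0 j0" unfolding W swapped_Cons_Suc p(3) ..
      qed (use p in simp)
      ultimately show ?thesis by simp
    next
      case none: False
      have "grid k v (i0, j0) = None" using none by (intro grid_eq_None) blast
      moreover have "grid k (x # v) (i0, j0) = None"
      proof (rule grid_eq_None, rule notI)
        fix p assume p: "i0 < k" "p < length (x # v)" "swapped (x # v) p = ?W i0 j0"
        show False
        proof (cases p)
          case 0
          then have "?W i0 j0 = ?W i j" using p(3) unfolding w by auto
          then have "k - i0 = k - i \<and> k + 1 + j0 = k + 1 + j"
            unfolding doubleton_eq_iff word_perm_eq_iff using i by auto
          then show False using False c p(1) i by auto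
        next
          case (Suc q)
          then have "transpose x (Suc x) ` swapped v q = transpose x (Suc x) ` ?V i0 j0"
            using p(3) unfolding W by simp
          then have "swapped v q = ?V i0 j0" by (metis inj_image_eq_iff inj_transpose)
          then show False using none p Suc by auto
        qed
      qed
      ultimately show ?thesis by simp
    qed
    show ?thesis unfolding fun_upd_other[OF False] unfolding c by (rule g)
  qed
qed

lemma grass_EG:
  "reduced w \<Longrightarrow> ascending_except k (word_perm w) \<Longrightarrow> \<exists>r h. grass_shape k w r h \<and>
    EG_P w = map (grass_row k r h) [0..<h 0] \<and> EG_Q w = grid k w \<and> dom (EG_Q w) = {(i, j). j < r i}"
proof (induction w)
  case Nil
  have "grid k [] = Map.empty" by (auto simp: grid_def)
  then show ?case
    by (intro exI[of _ "\<lambda>_. 0"] conjI) (simp_all add: grass_shape_Nil)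
next
  case (Cons x v)
  have rd: "red (x # v)" and rv: "reduced v"
    using Cons.prems(1) red_append2[of "[x]" v] by (auto simp: reduced_iff_red)
  have asc: "ascending_except k (word_perm v)" using Cons.prems by (rule ascending_except_tail)
  obtain r h where g: "grass_shape k v r h" and P: "EG_P v = map (grass_row k r h) [0..<h 0]"
    and Q: "EG_Q v = grid k v" and D: "dom (EG_Q v) = {(i, j). j < r i}" using Cons.IH[OF rv asc] by blast
  obtain i j where ij: "i < k" "r i = j" "h j = i" "x = k + j - i"
    "word_perm (x # v) (k - i) = Suc x" "word_perm (x # v) (k + 1 + j) = x"
    and g': "grass_shape k (x # v) (r(i := Suc j)) (h(j := Suc i))"
    using grass_shape_Cons[OF g Cons.prems] by metis
  have h: "\<And>j. h j \<le> k" and rh: "\<And>i j. j < r i \<longleftrightarrow> i < h j"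
    and rh': "\<And>i' j'. j' < (r(i := Suc j)) i' \<longleftrightarrow> i' < (h(j := Suc i)) j'"
    using g g' unfolding grass_shape_def by blast+
  have P': "EG_P (x # v) = map (grass_row k (r(i := Suc j)) (h(j := Suc i))) [0..<(h(j := Suc i)) 0]"
    using eg_insert_grass[OF h rh ij(2,3,1), of 0] by (simp add: EG_P_Cons P ij(4) del: fun_upd_apply)
  have "cells (EG_P (x # v)) = {(i', j'). j' < (r(i := Suc j)) i'}" unfolding P' by (rule cells_grass[OF rh'])
  moreover have "cells (EG_P v) = {(i, j). j < r i}" unfolding P by (rule cells_grass[OF rh])
  ultimately have new: "cells (EG_P (x # v)) - cells (EG_P v) = {(i, j)}"
    using ij(2) by (auto split: if_splits)
  then have Q': "EG_Q (x # v) = (EG_Q v)((i, j) \<mapsto> Suc (length v))" by (simp add: fun_eq_iff)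
  then have "dom (EG_Q (x # v)) = {(i', j'). j' < (r(i := Suc j)) i'}"
    using D ij(2) by (auto simp del: EG_Q.simps split: if_splits)
  moreover have "EG_Q (x # v) = grid k (x # v)" using Q' Q grid_Cons[OF rd ij(1,5,6)] by simp
  ultimately show ?case using g' P' by blast
qed

text \<open>The nonempty rows and columns of a partition form initial segments, so their enumeration
  is the identity.\<close>

lemma discard_empty_partition:
  assumes dom: "dom F = {(i, j). j < r i}" and rh: "\<And>i j. j < r i \<longleftrightarrow> i < h j"
  shows "discard_empty F = F"
proof -
  have R: "fst ` dom F = {..<h 0}"
  proof (intro equalityI subsetI)
    fix i assume "i \<in> fst ` dom F"
    then obtain j where "j < r i" using dom by auto
    then show "i \<in> {..<h 0}" using rh[of 0 i] by simp
  next
    fix i assume "i \<in> {..<h 0}"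
    then have "(i, 0) \<in> dom F" using dom rh[of 0 i] by simp
    then show "i \<in> fst ` dom F" by force
  qed
  have C: "snd ` dom F = {..<r 0}"
  proof (intro equalityI subsetI)
    fix j assume "j \<in> snd ` dom F"
    then obtain i where "j < r i" using dom by auto
    then show "j \<in> {..<r 0}" using rh[of j i] rh[of j 0] by simp
  next
    fix j assume "j \<in> {..<r 0}"
    then have "(0, j) \<in> dom F" using dom by simp
    then show "j \<in> snd ` dom F" by force
  qed
  have none: "F (i, j) = None" if "\<not> (i < h 0 \<and> j < r 0)" for i j
  proof -
    have "\<not> j < r i" using that rh[of j i] rh[of j 0] rh[of 0 i] by auto
    then have "(i, j) \<notin> dom F" using dom by simp
    then show ?thesis by (simp only: domIff not_not)
  qed
  show ?thesis
  proof
    fix c :: "nat \<times> nat"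
    obtain i j where c: "c = (i, j)" by fastforce
    show "discard_empty F c = F c"
      using none[of i j] by (simp add: c discard_empty_def R C lessThan_atLeast0)
  qed
qed

lemma ascending_except_descent:
  assumes "inj f" "\<And>c. c \<in> descents f \<Longrightarrow> c = k"
  shows "ascending_except k f"
  unfolding ascending_except_def
proof (intro allI impI)
  fix c assume c: "1 \<le> c" "c \<noteq> k"
  then have "\<not> f (Suc c) < f c" using assms(2)[of c] by (auto simp: descents_def)
  moreover have "f c \<noteq> f (Suc c)" by (simp add: inj_eq[OF assms(1)])
  ultimately show "f c < f (Suc c)" by simp
qed

lemma grassmannian_EG_Q:
  assumes "reduced w" "grassmannian (word_perm w)"
  shows "EG_Q w = Tab w"
proof -
  obtain k where k: "k \<in> descents (word_perm w)" "\<And>c. c \<in> descents (word_perm w) \<Longrightarrow> c = k"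
    using assms(2) unfolding grassmannian_def by blast
  have the: "(THE k. k \<in> descents (word_perm w)) = k" using k by (rule the_equality)
  have tg: "tab_grid w = grid k w" unfolding tab_grid_def grid_def Let_def the ..
  obtain r h where g: "grass_shape k w r h" and Q: "EG_Q w = grid k w" and D: "dom (EG_Q w) = {(i, j). j < r i}"
    using grass_EG[OF assms(1) ascending_except_descent[OF inj_word_perm k(2)]] by blast
  have "\<And>i j. j < r i \<longleftrightarrow> i < h j" using g by (simp add: grass_shape_def)
  from discard_empty_partition[OF D this] show ?thesis by (simp add: Tab_def tg Q)
qed

section \<open>Termination of the Little map\<close>

text \<open>Unlike \<^const>\<open>descents\<close> this counts a descent at position 0, which a pending shift can produce.\<close>

definition all_descents :: "(nat \<Rightarrow> nat) \<Rightarrow> nat set" where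
  "all_descents f = {c. f (Suc c) < f c}"

text \<open>A difference of positions, like the count below, does not notice the shift of a
  word.\<close>

definition descent_gap :: "(nat \<Rightarrow> nat) \<Rightarrow> nat" where
  "descent_gap f = Max (all_descents f) - Min (all_descents f)"

text \<open>The Lehmer code at the last descent.\<close>

definition last_code :: "(nat \<Rightarrow> nat) \<Rightarrow> nat" where
  "last_code f = card {d. Max (all_descents f) < d \<and> f d < f (Max (all_descents f))}"

lemma finite_all_descents [simp]: "finite (all_descents (word_perm w))"
proof -
  have "all_descents (word_perm w) \<subseteq> fst ` inv_pairs (word_perm w)"
    by (force simp: all_descents_def inv_pairs_def)
  then show ?thesis by (rule finite_subset) simp
qed

lemma all_descents_nonempty:
  assumes "red w" "w \<noteq> []"
  shows "all_descents (word_perm w) \<noteq> {}"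
proof
  assume none: "all_descents (word_perm w) = {}"
  have "word_perm w c < word_perm w (Suc c)" for c
  proof -
    have "\<not> word_perm w (Suc c) < word_perm w c" using none by (auto simp: all_descents_def)
    moreover have "word_perm w (Suc c) \<noteq> word_perm w c" by simp
    ultimately show ?thesis by linarith
  qed
  then have "strict_mono (word_perm w)" by (simp add: strict_mono_Suc_iff)
  from strict_mono_less[OF this] have "inv_pairs (word_perm w) = {}" by (simp add: inv_pairs_def)
  then show False using assms by (simp add: red_iff_card)
qed

lemma all_descents_map_Suc: "all_descents (word_perm (map Suc w)) = Suc ` all_descents (word_perm w)"
proof (intro set_eqI)
  fix c
  have "word_perm (map Suc w) 0 = 0" by (intro word_perm_0) auto
  then show "c \<in> all_descents (word_perm (map Suc w)) \<longleftrightarrow> c \<in> Suc ` all_descents (word_perm w)"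
    by (cases c) (auto simp: all_descents_def word_perm_map_Suc image_iff)
qed

lemma measures_map_Suc:
  assumes "red w" "w \<noteq> []"
  shows "descent_gap (word_perm (map Suc w)) = descent_gap (word_perm w)"
    "last_code (word_perm (map Suc w)) = last_code (word_perm w)"
proof -
  let ?D = "all_descents (word_perm w)" and ?f = "word_perm (map Suc w)"
  have ne: "?D \<noteq> {}" by (rule all_descents_nonempty[OF assms])
  have mono: "mono Suc" by (simp add: mono_def)
  have Max: "Max (Suc ` ?D) = Suc (Max ?D)" using mono_Max_commute[OF mono _ ne] by simp
  have Min: "Min (Suc ` ?D) = Suc (Min ?D)" using mono_Min_commute[OF mono _ ne] by simp
  show "descent_gap ?f = descent_gap (word_perm w)"
    by (simp add: descent_gap_def all_descents_map_Suc Max Min)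
  have "{d. Suc (Max ?D) < d \<and> ?f d < ?f (Suc (Max ?D))} =
      Suc ` {d. Max ?D < d \<and> word_perm w d < word_perm w (Max ?D)}"
  proof (intro set_eqI)
    fix d
    show "d \<in> {d. Suc (Max ?D) < d \<and> ?f d < ?f (Suc (Max ?D))} \<longleftrightarrow>
        d \<in> Suc ` {d. Max ?D < d \<and> word_perm w d < word_perm w (Max ?D)}"
      by (cases d) (auto simp: word_perm_map_Suc image_iff)
  qed
  then show "last_code ?f = last_code (word_perm w)"
    by (simp add: last_code_def all_descents_map_Suc Max card_image)
qed

lemma last_inversion_exists:
  assumes fin: "finite (inversions f)" and ne: "inversions f \<noteq> {}"
  obtains r s where "last_inversion f = (r, s)" "(r, s) \<in> inversions f"
    "\<And>r' s'. (r', s') \<in> inversions f \<Longrightarrow> r' < r \<or> r' = r \<and> s' \<le> s"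
proof -
  define r where "r = Max (fst ` inversions f)"
  define s where "s = Max {s. (r, s) \<in> inversions f}"
  have r: "r \<in> fst ` inversions f" unfolding r_def using fin ne by (intro Max_in) auto
  have fs: "finite {s. (r, s) \<in> inversions f}"
    by (rule finite_subset[OF _ finite_imageI[OF fin, of snd]]) force
  have "s \<in> {s. (r, s) \<in> inversions f}" unfolding s_def using r fs by (intro Max_in) auto
  then have mem: "(r, s) \<in> inversions f" by simp
  have max: "r' < r \<or> r' = r \<and> s' \<le> s" if inv: "(r', s') \<in> inversions f" for r' s'
  proof -
    have "r' \<in> fst ` inversions f" using inv by force
    then have "r' \<le> r" unfolding r_def using fin by (intro Max_ge) auto
    moreover have "s' \<le> s" if "r' = r" unfolding s_def using fs inv that by (intro Max_ge) auto
    ultimately show ?thesis by auto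
  qed
  have "last_inversion f = (r, s)"
    unfolding last_inversion_def
  proof (rule the_equality)
    show "case (r, s) of (r, s) \<Rightarrow> (r, s) \<in> inversions f \<and>
        (\<forall>(r', s')\<in>inversions f. r' < r \<or> r' = r \<and> s' \<le> s)"
      using mem max by auto
  next
    fix x assume "case x of (r, s) \<Rightarrow> (r, s) \<in> inversions f \<and>
        (\<forall>(r', s')\<in>inversions f. r' < r \<or> r' = r \<and> s' \<le> s)"
    then obtain r' s' where x: "x = (r', s')" "(r', s') \<in> inversions f"
      "\<forall>(r'', s'')\<in>inversions f. r'' < r' \<or> r'' = r' \<and> s'' \<le> s'" by (cases x) auto
    have "r' < r \<or> r' = r \<and> s' \<le> s" using max x(2) by blast
    moreover have "r < r' \<or> r = r' \<and> s \<le> s'" using x(3) mem by blast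
    ultimately show "x = (r, s)" using x(1) by auto
  qed
  then show thesis using that mem max by blast
qed

text \<open>The last descent of \<open>f\<close> is \<open>r\<close>, and \<open>g\<close> still
  increases beyond \<open>r\<close>, so the last descent does not move right; the cover condition
  prevents the first one from moving left. If \<open>r\<close> remains the last descent, its value
  drops from \<open>f r\<close> to \<open>f r0\<close>, below \<open>f s\<close>, and position
  \<open>s\<close> leaves the count.\<close>

lemma last_inversion_step_decreases:
  fixes f :: "nat \<Rightarrow> nat"
  assumes inj: "inj f" and rs: "r < s" "f s < f r"
    and last: "\<And>c d. r < c \<Longrightarrow> c < d \<Longrightarrow> f c < f d" "\<And>d. s < d \<Longrightarrow> f r < f d"
    and r0: "r0 < r" and cov: "f r0 < f s" "\<And>k. r0 < k \<Longrightarrow> k < r \<Longrightarrow> \<not> (f r0 < f k \<and> f k < f s)"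
    and g: "g = f \<circ> transpose r s \<circ> transpose r0 r"
    and finf: "finite (all_descents f)" and fing: "finite (all_descents g)" "all_descents g \<noteq> {}"
    and q: "q \<in> all_descents f" "q < r"
  shows "descent_gap g < descent_gap f \<or> descent_gap g = descent_gap f \<and> last_code g < last_code f"
proof -
  have gv: "g r0 = f s" "g r = f r0" "g s = f r"
    using r0 rs by (auto simp: g transpose_def)
  have go: "g c = f c" if "c \<noteq> r0" "c \<noteq> r" "c \<noteq> s" for c using that by (simp add: g transpose_def)
  have "f (Suc r) \<le> f s" using last(1)[of "Suc r" s] rs(1) by (cases "Suc r = s") auto
  then have rD: "r \<in> all_descents f" using rs by (simp add: all_descents_def)
  have Dle: "c \<le> r" if "c \<in> all_descents f" for c
    using last(1)[of c "Suc c"] that by (force simp: all_descents_def)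
  have Maxf: "Max (all_descents f) = r" using finf rD Dle by (intro Max_eqI) auto
  have ginc: "g c < g d" if "r < c" "c < d" for c d
  proof -
    consider "c = s" | "d = s" "c \<noteq> s" | "c \<noteq> s" "d \<noteq> s" by blast
    then show ?thesis
    proof cases
      case 1
      then show ?thesis using that last(2)[of d] gv(3) go[of d] r0 rs by simp
    next
      case 2
      then show ?thesis using that last(1)[of c s] gv(3) go[of c] r0 rs by simp
    next
      case 3
      then show ?thesis using that last(1)[of c d] go[of c] go[of d] r0 by simp
    qed
  qed
  have gle: "c \<le> r" if "c \<in> all_descents g" for c
    using ginc[of c "Suc c"] that by (force simp: all_descents_def)
  define m where "m = Min (all_descents f)"
  \<comment> \<open>The second descent \<open>q\<close> enters here: it keeps \<open>r\<close> and
    \<open>s\<close> out of the comparisons to the left of \<open>m\<close>.\<close>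
  have mr: "m < r" using finf q unfolding m_def by (meson Min_le order_le_less_trans)
  have finc: "f c < f (Suc c)" if "c < m" for c
  proof -
    have "c \<notin> all_descents f" using that finf unfolding m_def by (meson Min_le linorder_not_less)
    moreover have "f c \<noteq> f (Suc c)" by (simp add: inj_eq[OF inj])
    ultimately show ?thesis by (simp add: all_descents_def)
  qed
  have "c \<notin> all_descents g" if c: "c < m" for c
  proof -
    have f: "f c < f (Suc c)" by (rule finc[OF c])
    have cr: "Suc c < r" using c mr by simp
    have "g c < g (Suc c)"
    proof (cases "c = r0")
      case True
      \<comment> \<open>The value at \<open>r0\<close> rises to \<open>f s\<close>, but no value
        between the old and the new one stands before position \<open>r\<close>.\<close>
      have "\<not> f (Suc c) < f s" using cov(2)[of "Suc c"] True f cr by simp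
      moreover have "f (Suc c) \<noteq> f s" using cr rs by (simp add: inj_eq[OF inj])
      moreover have "g (Suc c) = f (Suc c)" using True cr rs by (intro go) auto
      ultimately show ?thesis using True gv(1) by simp
    next
      case False
      have gc: "g c = f c" using False cr rs by (intro go) auto
      show ?thesis
      proof (cases "Suc c = r0")
        case True
        then show ?thesis using gc gv(1) f cov(1) by simp
      next
        case False
        then have "g (Suc c) = f (Suc c)" using cr rs by (intro go) auto
        then show ?thesis using gc f by simp
      qed
    qed
    then show ?thesis by (simp add: all_descents_def)
  qed
  then have ming: "m \<le> Min (all_descents g)" using Min_in[OF fing] by (meson linorder_not_less)
  have maxg: "Max (all_descents g) \<le> r" using Max_in[OF fing] gle by blast
  have mm: "Min (all_descents g) \<le> Max (all_descents g)" using Min_in[OF fing] fing(1) by simp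
  have gapf: "descent_gap f = r - m" by (simp add: descent_gap_def Maxf m_def)
  show ?thesis
  proof (cases "Max (all_descents g) = r")
    case False
    then have "descent_gap g < r - m" unfolding descent_gap_def using ming maxg mm mr by linarith
    then show ?thesis by (simp add: gapf)
  next
    case True
    have "descent_gap g \<le> descent_gap f" unfolding gapf using ming by (simp add: descent_gap_def True)
    moreover have "last_code g < last_code f"
    proof -
      have "{d. r < d \<and> f d < f r} \<subseteq> {..s}" using last(2) by (force simp: not_le[symmetric])
      then have fin: "finite {d. r < d \<and> f d < f r}" by (rule finite_subset) simp
      have "d \<noteq> s \<and> f d < f r" if d: "r < d" "g d < f r0" for d
      proof -
        have "d \<noteq> s" using d gv(3) cov(1) rs(2) by auto
        then have "g d = f d" using d r0 by (intro go) auto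
        then show ?thesis using d cov(1) rs(2) \<open>d \<noteq> s\<close> by simp
      qed
      then have "{d. r < d \<and> g d < f r0} \<subset> {d. r < d \<and> f d < f r}" using rs by auto
      then show ?thesis unfolding last_code_def True Maxf gv(2) using fin by (intro psubset_card_mono)
    qed
    ultimately show ?thesis by linarith
  qed
qed

lemma all_descents_eq_descents: "0 \<notin> set w \<Longrightarrow> all_descents (word_perm w) = descents (word_perm w)"
  unfolding all_descents_def descents_def using word_perm_0[of w] by (auto simp: Suc_le_eq) (metis gr0I not_less0)

text \<open>Deleting the letter of the last inversion costs one inversion, and the bump regains one:
  \<open>r\<close> is the right end of the lower wire at the mark, so \<open>bump_perm\<close>
  exchanges it with some \<open>r0 < r\<close>. The count of inversions makes this exchange a
  cover.\<close>

lemma Little_step: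
  assumes red: "reduced w" and ne: "w \<noteq> []" and ng: "\<not> grassmannian (word_perm w)"
    and li: "last_inversion (word_perm w) = (r, s)"
  obtains i v where "(THE i. i < length w \<and> swapped w i = {word_perm w r, word_perm w s}) = i"
    "little_bump w i = Some v" "reduced v" "EG_Q v = EG_Q w"
    "descent_gap (word_perm v) < descent_gap (word_perm w) \<or>
     descent_gap (word_perm v) = descent_gap (word_perm w) \<and> last_code (word_perm v) < last_code (word_perm w)"
proof -
  let ?f = "word_perm w"
  have z: "0 \<notin> set w" and rd: "red w" using red by (auto simp: reduced_iff_red)
  have f0: "?f 0 = 0" using z by (rule word_perm_0)
  have inv: "inversions ?f = inv_pairs ?f" using f0 by (rule inversions_eq_inv_pairs)
  have "card (inversions ?f) = length w" using rd by (simp add: red_iff_card inv)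
  then have "inversions ?f \<noteq> {}" using ne by auto
  then obtain r' s' where "last_inversion ?f = (r', s')" "(r', s') \<in> inversions ?f"
    "\<And>r'' s''. (r'', s'') \<in> inversions ?f \<Longrightarrow> r'' < r' \<or> r'' = r' \<and> s'' \<le> s'"
    using last_inversion_exists[of ?f] inv by auto
  then have rs_inv: "(r, s) \<in> inv_pairs ?f"
    and max: "\<And>r'' s''. (r'', s'') \<in> inv_pairs ?f \<Longrightarrow> r'' < r \<or> r'' = r \<and> s'' \<le> s"
    using li inv by auto
  have rs: "r < s" "?f s < ?f r" using rs_inv by (auto simp: inv_pairs_def)
  have last1: "?f c < ?f d" if "r < c" "c < d" for c d
  proof -
    have "(c, d) \<notin> inv_pairs ?f" using max[of c d] that by auto
    then have "\<not> ?f d < ?f c" using that by (simp add: inv_pairs_def)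
    moreover have "?f c \<noteq> ?f d" using that by simp
    ultimately show ?thesis by linarith
  qed
  have last2: "?f r < ?f d" if "s < d" for d
  proof -
    have "(r, d) \<notin> inv_pairs ?f" using max[of r d] that by auto
    then have "\<not> ?f d < ?f r" using that rs by (simp add: inv_pairs_def)
    moreover have "?f r \<noteq> ?f d" using that rs by simp
    ultimately show ?thesis by linarith
  qed
  obtain i where i: "i < length w" "swapped w i = {?f r, ?f s}" using inversion_swapped[OF rs_inv] by blast
  have the: "(THE i. i < length w \<and> swapped w i = {?f r, ?f s}) = i"
    using i redD[OF rd] by (intro the_equality) auto
  have tau: "word_perm (del i w) = ?f \<circ> transpose r s"
  proof
    fix c
    have "?f c = transpose (?f r) (?f s) (word_perm (del i w) c)"
      using fun_cong[OF word_perm_del[OF i], of c] unfolding comp_apply .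
    from arg_cong[OF this, of "transpose (?f r) (?f s)"]
    have "word_perm (del i w) c = transpose (?f r) (?f s) (?f c)" unfolding transpose_involutory by (rule sym)
    also have "\<dots> = ?f (transpose r s c)" by (rule transpose_inj_conj) simp
    finally show "word_perm (del i w) c = (?f \<circ> transpose r s) c" by simp
  qed
  \<comment> \<open>Beyond \<open>r\<close> the values increase, so those between positions
    \<open>r\<close> and \<open>s\<close> lie below \<open>?f s\<close>, and only the inversion
    \<open>(r, s)\<close> is lost.\<close>
  have "card (inv_pairs ?f) \<le> Suc (card (inv_pairs (?f \<circ> transpose r s)))"
  proof (rule card_inv_pairs_cover)
    show "finite (inv_pairs (?f \<circ> transpose r s))" unfolding tau[symmetric] by simp
    show "?f k < ?f s \<or> ?f r < ?f k" if "r < k" "k < s" for k using last1[OF that] by simp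
  qed (use rs in simp_all)
  then have rdel: "red (del i w)"
    using card_inv_pairs_le[of "del i w"] rd i(1) ne unfolding tau[symmetric] red_iff_card by simp
  then have m: "marked w i" using i z by (simp add: marked_def)
  obtain a k b where w: "w = a @ k # b" "i = length a" using split_at_index i(1) .
  have "{word_perm a k, word_perm a (Suc k)} = {?f r, ?f s}" using i(2) by (simp add: w)
  then have "word_perm a ` {k, Suc k} = word_perm a ` transpose k (Suc k) ` {word_perm b r, word_perm b s}"
    by (simp add: w word_perm_append)
  then have "transpose k (Suc k) ` {word_perm b r, word_perm b s} = {k, Suc k}"
    by (metis inj_image_eq_iff inj_word_perm)
  then have "{word_perm b r, word_perm b s} = {k, Suc k}" unfolding transpose_image_pair .
  moreover have "\<not> (word_perm b r = Suc k \<and> word_perm b s = k)"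
  proof
    assume "word_perm b r = Suc k \<and> word_perm b s = k"
    then have "word_perm (rev b) (Suc k) = r" "word_perm (rev b) k = s" by (metis word_perm_rev_cancel)+
    moreover have "word_perm (rev b) k < word_perm (rev b) (Suc k)"
      using rd red_append2[of a "k # b"] by (intro red_Cons_ascent) (simp add: w)
    ultimately show False using rs by simp
  qed
  ultimately have lower: "word_perm (drop (Suc i) w) r = w ! i"
    by (auto simp only: doubleton_eq_iff w) (simp_all add: w)
  obtain v where v: "bump w i v" using bump_exists[OF m] by blast
  obtain r0 where r0: "r0 < r" "word_perm v = word_perm (del i w) \<circ> transpose r0 r"
    using bump_perm[OF v m lower] by blast
  have rv: "red v" and lv: "length v = length w" using bump_red[OF v] bump_length[OF v] by auto
  then have vne: "v \<noteq> []" using ne by auto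
  let ?t = "word_perm (del i w)"
  \<comment> \<open>Both words are reduced and differ in length by one. The strict inequalities for
    other exchanges contradict this count and leave only \<open>cov1\<close> and
    \<open>cov2\<close>.\<close>
  have cg: "card (inv_pairs (?t \<circ> transpose r0 r)) = Suc (card (inv_pairs ?t))"
    using rv rdel lv i(1) unfolding r0(2)[symmetric] red_iff_card by simp
  have fing: "finite (inv_pairs (?t \<circ> transpose r0 r))" unfolding r0(2)[symmetric] by simp
  have tv: "?t r0 = ?f r0" "?t r = ?f s" using r0(1) rs by (simp_all add: tau)
  have "\<not> ?t r < ?t r0"
  proof
    assume "?t r < ?t r0"
    then have lt: "(?t \<circ> transpose r0 r) r0 < (?t \<circ> transpose r0 r) r" by simp
    have tt: "?t \<circ> transpose r0 r \<circ> transpose r0 r = ?t" by (simp add: comp_assoc)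
    have "card (inv_pairs (?t \<circ> transpose r0 r)) < card (inv_pairs ?t)"
      using card_inv_pairs_transpose_gt[of "?t \<circ> transpose r0 r" r0 r] r0(1) lt unfolding tt by simp
    then show False using cg by simp
  qed
  moreover have "?t r0 \<noteq> ?t r" using r0(1) by simp
  ultimately have cov1: "?f r0 < ?f s" using tv by linarith
  have cov2: "\<not> (?f r0 < ?f k \<and> ?f k < ?f s)" if k: "r0 < k" "k < r" for k
  proof
    assume "?f r0 < ?f k \<and> ?f k < ?f s"
    moreover have "?t k = ?f k" using k rs by (simp add: tau)
    ultimately have "card (inv_pairs ?t) + 2 \<le> card (inv_pairs (?t \<circ> transpose r0 r))"
      using k tv by (intro card_inv_pairs_transpose_gt2[OF fing]) auto
    then show False using cg by simp
  qed
  have "\<exists>q\<in>all_descents ?f. q < r"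
  proof -
    have D: "all_descents ?f = descents ?f" by (rule all_descents_eq_descents[OF z])
    have le: "c \<le> r" if "c \<in> all_descents ?f" for c
      using last1[of c "Suc c"] that by (force simp: all_descents_def)
    have "descents ?f \<noteq> {}" using all_descents_nonempty[OF rd ne] D by simp
    moreover have "\<not> (\<exists>!c. c \<in> descents ?f)" using ng by (simp add: grassmannian_def)
    ultimately obtain c d where "c \<in> descents ?f" "d \<in> descents ?f" "c \<noteq> d" by blast
    then show ?thesis using le D by (metis le_neq_implies_less)
  qed
  then obtain q where q: "q \<in> all_descents ?f" "q < r" by blast
  have dec: "descent_gap (word_perm v) < descent_gap ?f \<or>
     descent_gap (word_perm v) = descent_gap ?f \<and> last_code (word_perm v) < last_code ?f"
    using last_inversion_step_decreases[OF inj_word_perm rs last1 last2 r0(1) cov1 cov2 r0(2)[unfolded tau]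
        finite_all_descents finite_all_descents all_descents_nonempty[OF rv vne] q] .
  have "descent_gap (word_perm (unzero v)) = descent_gap (word_perm v)"
    "last_code (word_perm (unzero v)) = last_code (word_perm v)"
    using measures_map_Suc[OF rv vne] by (simp_all add: unzero_def)
  then show thesis
    using that[of i "unzero v"] the bump_little_bump[OF v m] rv dec EG_Q_little_bump[OF rd m v]
    by (simp add: reduced_unzero)
qed

theorem theorem1p1:
  fixes w :: "nat list"
  assumes "reduced w"
  shows "LS w = Some (EG_Q w)"
  using assms
proof (induction w rule: wf_induct_rule[OF wf_measures[of
    "[\<lambda>w. descent_gap (word_perm w), \<lambda>w. last_code (word_perm w)]"]])
  case (1 w)
  show ?case
  proof (cases "w = [] \<or> grassmannian (word_perm w)")
    case True
    then show ?thesis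
      using grassmannian_EG_Q[OF 1(2)] by (subst LS.simps) auto
  next
    case False
    then have ne: "w \<noteq> []" and ng: "\<not> grassmannian (word_perm w)" by auto
    obtain r s where li: "last_inversion (word_perm w) = (r, s)" by fastforce
    obtain i v where v: "(THE i. i < length w \<and> swapped w i = {word_perm w r, word_perm w s}) = i"
      "little_bump w i = Some v" "reduced v" "EG_Q v = EG_Q w"
      "descent_gap (word_perm v) < descent_gap (word_perm w) \<or>
       descent_gap (word_perm v) = descent_gap (word_perm w) \<and> last_code (word_perm v) < last_code (word_perm w)"
      using Little_step[OF 1(2) ne ng li] .
    have "LS v = Some (EG_Q v)" using v(3,5) by (intro 1(1)) auto
    then show ?thesis
      using ne ng v(2,4) by (subst LS.simps) (simp add: Let_def li v(1))
  qed
qed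

end
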